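(* Let $\alpha>0$ and let $X=(X_1,\dots,X_n)$ be an $\alpha$-permanental vector with non-singular kernel $K$. Assume that $A=K^{-1}$ is a nonsingular $M$-matrix with diagonal entries $(a_1,\dots,a_n)$, and let $\xi^{(1)}_{\alpha,1},\dots,\xi^{(n)}_{\alpha,1}$ be independent identically distributed copies of $\xi_{\alpha,1}$. Then for every increasing function $f$ on $\mathbb{R}^n_+$ (for which the expectations below are defined), $$E(f(X))\ \ge\ E\left(f(a_1^{-1}\xi^{(1)}_{\alpha,1},\dots,a_n^{-1}\xi^{(n)}_{\alpha,1})\right).$$ Equivalently, for every such $f$, $$E\left(f(a_1X_1,\dots,a_nX_n)\right)\ \ge\ E\left(f(\xi^{(1)}_{\alpha,1},\dots,\xi^{(n)}_{\alpha,1})\right).$$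
   Context: For $\alpha>0$ and a real $n\times n$ matrix $K$, an $\alpha$-permanental vector with kernel $K$ is a random vector $X=(X_1,\dots,X_n)$ with non-negative components such that $E\left(e^{-\sum_{i=1}^n s_iX_i}\right)=|I+KS|^{-\alpha}$ for all $s_1,\dots,s_n\ge 0$, where $S$ is the diagonal matrix with entries $s_1,\dots,s_n$ and $|\cdot|$ denotes the determinant. A real $n\times n$ matrix $A=(a_{i,j})$ is a nonsingular $M$-matrix if $a_{i,j}\le 0$ for all $i\ne j$, $A$ is nonsingular, and all entries of $A^{-1}$ are $\ge 0$. For $u,v>0$, $\xi_{u,v}$ denotes a gamma random variable with density $v^u x^{u-1}e^{-vx}/\Gamma(u)$ on $x>0$. A function $f$ on $\mathbb{R}^n_+$ is increasing if $f(x)\le f(y)$ whenever $x_i\le y_i$ for all $i$. *)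

theory Defs
  imports "HOL-Probability.Probability"
begin

definition diag_mat :: "real ^ 'n \<Rightarrow> real ^ 'n ^ 'n" where
  "diag_mat s = (\<chi> i j. if i = j then s $ i else 0)"

text \<open>Non-negativity of the components is only required almost surely. The determinant is
  automatically positive when the equation holds for all \<open>s \<ge> 0\<close>: the left-hand side is never
  \<open>0 = 0 powr (- \<alpha>)\<close>, the determinant is continuous in \<open>s\<close>, and it is \<open>1\<close> at \<open>s = 0\<close>.
  Hence \<open>powr\<close> is used only where it is the usual real power.\<close>

definition permanental_vector ::
    "'a measure \<Rightarrow> real \<Rightarrow> real ^ 'n ^ 'n \<Rightarrow> ('a \<Rightarrow> real ^ 'n) \<Rightarrow> bool" where
  "permanental_vector M \<alpha> K X \<longleftrightarrow>
     prob_space M \<and> X \<in> borel_measurable M \<and>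
     (AE \<omega> in M. \<forall>i. 0 \<le> X \<omega> $ i) \<and>
     (\<forall>s. (\<forall>i. 0 \<le> s $ i) \<longrightarrow>
        (\<integral>\<omega>. exp (- (\<Sum>i\<in>UNIV. s $ i * X \<omega> $ i)) \<partial>M)
          = det (mat 1 + K ** diag_mat s) powr (- \<alpha>))"

definition nonsingular_M_matrix :: "real ^ 'n ^ 'n \<Rightarrow> bool" where
  "nonsingular_M_matrix A \<longleftrightarrow>
     (\<forall>i j. i \<noteq> j \<longrightarrow> A $ i $ j \<le> 0) \<and> invertible A \<and> (\<forall>i j. 0 \<le> matrix_inv A $ i $ j)"

definition gamma_density :: "real \<Rightarrow> real \<Rightarrow> real \<Rightarrow> real" where
  "gamma_density u v x =
     (if 0 < x then v powr u * x powr (u - 1) * exp (- v * x) / Gamma u else 0)"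

definition gamma_distributed :: "'a measure \<Rightarrow> real \<Rightarrow> real \<Rightarrow> ('a \<Rightarrow> real) \<Rightarrow> bool" where
  "gamma_distributed M u v Z \<longleftrightarrow> distributed M lborel Z (\<lambda>x. ennreal (gamma_density u v x))"

text \<open>The order on \<open>real ^ 'n\<close> is the componentwise one. A function on the closed orthant is
  represented by a total function whose values outside the orthant are irrelevant.\<close>

definition increasing_on_orthant :: "(real ^ 'n \<Rightarrow> real) \<Rightarrow> bool" where
  "increasing_on_orthant f \<longleftrightarrow> mono_on {x. 0 \<le> x} f"

text \<open>The Bochner integral is \<open>0\<close> for non-integrable functions, so expectations are taken in the
  extended sense: \<open>E g = E g\<^sup>+ - E g\<^sup>-\<close>, defined when \<open>g\<close> is measurable and at least one of the
  two terms is finite. Here \<open>ennreal\<close> maps negative reals to \<open>0\<close>.\<close>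

definition has_expectation :: "'a measure \<Rightarrow> ('a \<Rightarrow> real) \<Rightarrow> bool" where
  "has_expectation M g \<longleftrightarrow>
     g \<in> borel_measurable M \<and>
     ((\<integral>\<^sup>+ \<omega>. ennreal (g \<omega>) \<partial>M) < \<infinity> \<or> (\<integral>\<^sup>+ \<omega>. ennreal (- g \<omega>) \<partial>M) < \<infinity>)"

definition ext_expectation :: "'a measure \<Rightarrow> ('a \<Rightarrow> real) \<Rightarrow> ereal" where
  "ext_expectation M g =
     enn2ereal (\<integral>\<^sup>+ \<omega>. ennreal (g \<omega>) \<partial>M) - enn2ereal (\<integral>\<^sup>+ \<omega>. ennreal (- g \<omega>) \<partial>M)"

lemma integrable_has_expectation:
  assumes "integrable M g"
  shows "has_expectation M g" "ext_expectation M g = ereal (integral\<^sup>L M g)"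
proof -
  let ?p = "\<integral>\<^sup>+ \<omega>. ennreal (g \<omega>) \<partial>M" and ?n = "\<integral>\<^sup>+ \<omega>. ennreal (- g \<omega>) \<partial>M"
  have fin: "?p < \<infinity>" "?n < \<infinity>"
    using assms by (auto simp: real_integrable_def less_top)
  then show "has_expectation M g"
    using assms by (simp add: has_expectation_def)
  have "enn2ereal x = ereal (enn2real x)" if "x < \<infinity>" for x :: ennreal
    using that by (cases x) (auto simp: enn2ereal_ennreal)
  with fin show "ext_expectation M g = ereal (integral\<^sup>L M g)"
    by (simp add: ext_expectation_def real_lebesgue_integral_def[OF assms])
qed

end

(* After rescaling, the kernel of Y = (a_1 X_1, ..., a_n X_n) has inverse I - C with C nonnegative, so the
   Laplace transform of Y is a constant times det (I + S - C) powr (- alpha).  Gaussian elimination writes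
   this determinant as the product of (1 + s_j) (1 - w_j), where every w_j is a power series with
   nonnegative coefficients in the variables 1 / (1 + s_i); the M-matrix condition gives w_j < 1.
   Hence the Laplace transform is that of the gamma vector xi times such a power series.  Each monomial in
   1 / (1 + s_i) corresponds to a monomial density in x with respect to the law of xi, and so, by
   uniqueness of Laplace transforms, Y has an increasing density h with respect to that law.  The
   inequality is then Harris' inequality E (f(xi) h(xi)) >= E f(xi) E h(xi).
   Increasing functions need not be Borel measurable; they are squeezed between Borel functions
   using a lower semicontinuous regularization and a dilation of the gamma law. *)
theory Submission
  imports Defs
begin

section \<open>Powers of determinants as power series with nonnegative coefficients\<close>

text \<open>Two obstacles shape the proof. The first is positivity of the coefficients. Expanding
  the determinant and then taking a real power would call for a logarithm or for combinatorics of
  multi-indices. In the elimination only sums, products and powers (1 - w) powr (- \<beta>) occur,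
  with \<beta> = 1 for dividing by a pivot and \<beta> = \<alpha> for its contribution to the
  result; each of these keeps coefficients nonnegative. The class is therefore defined by closure
  under pointwise convergent series and not by coefficients, and the density is built along the same
  induction, so no coefficient is ever computed. The second is measurability. f(X) and f(\<xi>) are
  measurable on their own probability spaces, but an f that is not Borel cannot be integrated
  against the laws on the vector space, where the density lives. Domination is therefore proved for
  \<open>nn_integral\<close> of arbitrary increasing functions, where it is the supremum over simple
  functions below; signs are restored at the end by truncating the negative part.\<close>

text \<open>The rule \<open>sums\<close> leaves the values of \<open>F\<close> outside the orthant unconstrained.\<close>

inductive geom_class :: "(real ^ 'n \<Rightarrow> real) \<Rightarrow> bool" where
  monomial: "0 \<le> c \<Longrightarrow> geom_class (\<lambda>s. c * (\<Prod>i\<in>UNIV. inverse (1 + s $ i) ^ k i))"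
| sums: "(\<And>n. geom_class (f n)) \<Longrightarrow> (\<And>s. 0 \<le> s \<Longrightarrow> (\<lambda>n::nat. f n s) sums F s) \<Longrightarrow> geom_class F"

lemma vec_nonneg_iff: "0 \<le> (s :: real ^ 'n) \<longleftrightarrow> (\<forall>i. 0 \<le> s $ i)"
  by (simp add: less_eq_vec_def)

lemma geom_class_const: "0 \<le> c \<Longrightarrow> geom_class (\<lambda>_. c)"
  using geom_class.monomial[of c "\<lambda>_. 0"] by simp

lemma geom_class_var: "geom_class (\<lambda>s. inverse (1 + s $ j))"
  using geom_class.monomial[of 1 "\<lambda>i. if i = j then 1 else 0"]
  by (simp add: if_distrib[of "\<lambda>k. _ ^ k"] prod.delta cong: if_cong)

text \<open>The rule \<open>sums\<close> constrains its limit only on the orthant, so a series with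
  a single nonzero term may change the values elsewhere.\<close>

lemma geom_class_cong:
  assumes "geom_class G" "\<And>s. 0 \<le> s \<Longrightarrow> F s = G s"
  shows "geom_class F"
proof (rule geom_class.sums)
  show "geom_class (\<lambda>s. if n = 0 then G s else 0)" for n :: nat
    by (cases "n = 0") (simp_all add: assms geom_class_const)
  show "(\<lambda>n. if n = 0 then G s else 0) sums F s" if "0 \<le> s" for s
    using sums_If_finite_set[of "{0::nat}" "\<lambda>_. G s"] assms(2)[OF that] by simp
qed

lemma geom_class_add:
  assumes "geom_class F" "geom_class G"
  shows "geom_class (\<lambda>s. F s + G s)"
proof (rule geom_class.sums)
  show "geom_class (\<lambda>s. if n = 0 then F s else if n = 1 then G s else 0)" for n :: nat
    using assms by (cases "n = 0"; cases "n = 1") (simp_all add: geom_class_const)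
  show "(\<lambda>n. if n = 0 then F s else if n = 1 then G s else 0) sums (F s + G s)" for s
  proof -
    have "(\<lambda>n::nat. if n = 0 then F s else if n = 1 then G s else 0) =
      (\<lambda>n. if n \<in> {0, 1} then if n = 0 then F s else G s else 0)"
      by auto
    then show ?thesis
      using sums_If_finite_set[of "{0,1::nat}" "\<lambda>n. if n = 0 then F s else G s"] by simp
  qed
qed

text \<open>Nested inductions replace a Cauchy product: two monomials multiply by adding exponents,
  and a fixed factor passes through a convergent series term by term.\<close>

lemma geom_class_mult:
  assumes "geom_class F" "geom_class G"
  shows "geom_class (\<lambda>s. F s * G s)"
  using assms(1)
proof induction
  case (monomial c k)
  from assms(2) show ?case
  proof induction
    case (monomial d l)
    show ?case
      using geom_class.monomial[of "c * d" "\<lambda>i. k i + l i"] \<open>0 \<le> c\<close> monomial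
      by (simp add: power_add prod.distrib mult_ac)
  next
    case (sums f F)
    show ?case
      by (rule geom_class.sums[of "\<lambda>n s. c * (\<Prod>i\<in>UNIV. inverse (1 + s $ i) ^ k i) * f n s"])
        (intro sums.IH sums_mult sums.hyps; assumption)+
  qed
next
  case (sums f F)
  show ?case
    by (rule geom_class.sums[of "\<lambda>n s. f n s * G s"])
      (intro sums.IH sums_mult2 sums.hyps; assumption)+
qed

lemma geom_class_power: "geom_class F \<Longrightarrow> geom_class (\<lambda>s. F s ^ n)"
  by (induction n) (simp_all add: geom_class_const geom_class_mult)

lemma geom_class_nonneg: "geom_class F \<Longrightarrow> 0 \<le> s \<Longrightarrow> 0 \<le> F s"
proof (induction rule: geom_class.induct)
  case (monomial c k)
  then show ?case
    by (auto intro!: mult_nonneg_nonneg prod_nonneg simp: vec_nonneg_iff)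
next
  case (sums f F)
  show ?case
    by (rule sums_le[OF _ sums_zero sums.hyps(2)[OF sums.prems]]) (rule sums.IH[OF sums.prems])
qed

text \<open>In the binomial series the signs of \<open>- \<alpha> gchoose n\<close> and
  \<open>(- F s) ^ n\<close> cancel, leaving the coefficients
  \<open>pochhammer \<alpha> n / fact n\<close>, which are nonnegative because \<alpha> > 0.\<close>

lemma geom_class_binomial:
  assumes F: "geom_class F" "\<And>s. 0 \<le> s \<Longrightarrow> F s < 1" and \<alpha>: "0 < \<alpha>"
  shows "geom_class (\<lambda>s. (1 - F s) powr (- \<alpha>))"
proof (rule geom_class.sums)
  show "geom_class (\<lambda>s. pochhammer \<alpha> n / fact n * F s ^ n)" for n
    using \<alpha> F(1)
    by (intro geom_class_mult geom_class_power geom_class_const divide_nonneg_pos pochhammer_nonneg) auto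
  show "(\<lambda>n. pochhammer \<alpha> n / fact n * F s ^ n) sums (1 - F s) powr - \<alpha>" if "0 \<le> s" for s
  proof -
    have "\<bar>- F s\<bar> < 1" using F(2)[OF that] geom_class_nonneg[OF F(1) that] by simp
    moreover have "(- \<alpha> gchoose n) * (- F s) ^ n = pochhammer \<alpha> n / fact n * F s ^ n" for n
      by (cases "even n") (simp_all add: gbinomial_pochhammer)
    ultimately show ?thesis
      using gen_binomial_real[of "- F s" "- \<alpha>"] by simp
  qed
qed

section \<open>Gaussian elimination on principal blocks\<close>

text \<open>Padding with the identity outside J makes the determinant the principal minor on J,
  while all blocks share one matrix type and the induction can run over sets J.\<close>

definition principal_block :: "'n set \<Rightarrow> ('n \<Rightarrow> 'n \<Rightarrow> real) \<Rightarrow> real ^ 'n ^ 'n" where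
  "principal_block J T = (\<chi> i k. if i \<in> J \<and> k \<in> J then T i k else if i = k then 1 else 0)"

text \<open>Only the identity permutation contributes. If p moves j, the factor from row j vanishes;
  if p fixes j, a moved row i has p i different from j, and off the diagonal only column j can be
  nonzero.\<close>

lemma det_unit_column_perturbation:
  fixes l :: "'n::finite \<Rightarrow> real"
  assumes "l j = 0"
  shows "det (\<chi> i k. (if i = k then 1 else 0) + (if k = j then l i else 0)) = 1"
proof -
  define L :: "real ^ 'n ^ 'n"
    where "L = (\<chi> i k. (if i = k then 1 else 0) + (if k = j then l i else 0))"
  have L: "L $ i $ k = (if i = k then 1 else 0) + (if k = j then l i else 0)" for i k
    by (simp add: L_def)
  have zero: "(\<Prod>i\<in>UNIV. L $ i $ p i) = 0" if p: "p permutes UNIV" "p \<noteq> id" for p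
  proof -
    obtain i where i: "p i \<noteq> i" using p by fastforce
    have "L $ i $ p i = 0 \<or> L $ j $ p j = 0"
    proof (cases "p j = j")
      case True
      then have "p i \<noteq> j" using i permutes_inj[OF p(1)] by (auto dest: injD)
      then show ?thesis using i by (simp add: L)
    qed (simp add: L)
    then show ?thesis by (auto intro: prod_zero[OF finite])
  qed
  have "det L = (\<Sum>p\<in>{id}. of_int (sign p) * (\<Prod>i\<in>UNIV. L $ i $ p i))"
    unfolding det_def
    by (intro sum.mono_neutral_right) (auto simp: finite_permutations permutes_id zero)
  also have "L $ i $ i = 1" for i
    using assms by (cases "i = j") (simp_all add: L)
  then have "(\<Sum>p\<in>{id}. of_int (sign p) * (\<Prod>i\<in>UNIV. L $ i $ p i)) = 1"
    by simp
  finally show ?thesis by (simp add: L_def)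
qed

text \<open>One elimination step as a factorization \<open>L ** D ** transpose R\<close>: the
  multipliers of column j sit in L, those of row j in R, and both matrices have determinant 1. What
  is left on J is the Schur complement of the pivot.\<close>

lemma det_principal_block_insert:
  fixes T :: "'n::finite \<Rightarrow> 'n \<Rightarrow> real"
  assumes j: "j \<notin> J" and t: "T j j \<noteq> 0"
  shows "det (principal_block (insert j J) T) =
    T j j * det (principal_block J (\<lambda>i k. T i k - T i j * T j k / T j j))"
    (is "_ = _ * det ?P")
proof -
  define l where "l i = (if i \<in> J then T i j / T j j else 0)" for i
  define r where "r k = (if k \<in> J then T j k / T j j else 0)" for k
  define L :: "real ^ 'n ^ 'n" where "L = (\<chi> i k. (if i = k then 1 else 0) + (if k = j then l i else 0))"
  define R :: "real ^ 'n ^ 'n" where "R = (\<chi> i k. (if i = k then 1 else 0) + (if k = j then r i else 0))"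
  \<comment> \<open>As j lies outside J, row j of \<open>?P\<close> is a unit row; scaling it puts
    the pivot on the diagonal.\<close>
  define D :: "real ^ 'n ^ 'n" where "D = (\<chi> i. if i = j then T j j *s (?P $ i) else ?P $ i)"
  have "det L = 1" "det R = 1"
    unfolding L_def R_def using j by (auto intro!: det_unit_column_perturbation simp: l_def r_def)
  moreover have "det D = T j j * det ?P"
    unfolding D_def by (subst det_row_mul) simp
  moreover have "principal_block (insert j J) T = L ** D ** transpose R"
  proof -
    have LD: "(L ** D) $ i $ k = D $ i $ k + l i * D $ j $ k" for i k
      by (simp add: matrix_matrix_mult_def L_def distrib_right sum.distrib
          if_distrib[of "\<lambda>x. x * _"] cong: if_cong)
    have "(L ** D ** transpose R) $ i $ k = (L ** D) $ i $ k + (L ** D) $ i $ j * r k" for i k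
      unfolding matrix_matrix_mult_def[of "L ** D"]
      by (simp add: transpose_def R_def distrib_left sum.distrib
          if_distrib[of "\<lambda>x. _ * x"] cong: if_cong)
    then have "(L ** D ** transpose R) $ i $ k
      = D $ i $ k + l i * D $ j $ k + (D $ i $ j + l i * D $ j $ j) * r k" for i k
      by (simp only: LD)
    moreover have D: "D $ i $ k = (if i = j \<and> k = j then T j j else if i \<in> J \<and> k \<in> J
      then T i k - T i j * T j k / T j j else if i = k then 1 else 0)" for i k
      using j by (auto simp: D_def principal_block_def)
    have "principal_block (insert j J) T $ i $ k
      = D $ i $ k + l i * D $ j $ k + (D $ i $ j + l i * D $ j $ j) * r k" for i k
      using j t by (cases "i \<in> J"; cases "k \<in> J"; cases "i = j"; cases "k = j")
        (simp_all add: D l_def r_def principal_block_def)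
    ultimately show ?thesis by (simp only: vec_eq_iff) simp
  qed
  ultimately show ?thesis by (simp add: det_mul)
qed

text \<open>A positive vector \<open>x\<close> with \<open>T x > 0\<close> certifies that the pivots are positive, and it remains a
  certificate for the Schur complement.\<close>

lemma Schur_dominance:
  fixes T :: "'n \<Rightarrow> 'n \<Rightarrow> real"
  assumes J: "finite J" "j \<notin> J"
    and off: "\<And>i k. i \<in> insert j J \<Longrightarrow> k \<in> insert j J \<Longrightarrow> i \<noteq> k \<Longrightarrow> T i k \<le> 0"
    and x: "\<And>i. i \<in> insert j J \<Longrightarrow> 0 < x i"
    and Tx: "\<And>i. i \<in> insert j J \<Longrightarrow> 0 < (\<Sum>k\<in>insert j J. T i k * x k)"
  shows "0 < T j j"
    and "i \<in> J \<Longrightarrow> 0 < (\<Sum>k\<in>J. (T i k - T i j * T j k / T j j) * x k)"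
proof -
  have "(\<Sum>k\<in>J. T j k * x k) \<le> 0"
    by (intro sum_nonpos mult_nonpos_nonneg less_imp_le[OF x] off) (use J in auto)
  with Tx[of j] J have "0 < T j j * x j" by simp
  then show t: "0 < T j j" using x[of j] by (simp add: zero_less_mult_iff)
  assume i: "i \<in> J"
  \<comment> \<open>The multiplier of row j is nonpositive and row j of T x is positive, so
    elimination can only increase row i of T x.\<close>
  have "T i j / T j j \<le> 0" using off[of i j] i J t by (intro divide_nonpos_pos) auto
  then have "T i j / T j j * (\<Sum>k\<in>insert j J. T j k * x k) \<le> 0"
    using Tx[of j] by (intro mult_nonpos_nonneg) auto
  moreover have "(\<Sum>k\<in>J. (T i k - T i j * T j k / T j j) * x k) =
     (\<Sum>k\<in>insert j J. T i k * x k) - T i j / T j j * (\<Sum>k\<in>insert j J. T j k * x k)"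
  proof -
    have "(\<Sum>k\<in>J. (T i k - T i j * T j k / T j j) * x k) =
      (\<Sum>k\<in>J. T i k * x k) - T i j / T j j * (\<Sum>k\<in>J. T j k * x k)"
      unfolding sum_distrib_left sum_subtractf[symmetric]
      by (rule sum.cong) (simp_all add: algebra_simps)
    then show ?thesis using J t by (simp add: algebra_simps)
  qed
  ultimately show "0 < (\<Sum>k\<in>J. (T i k - T i j * T j k / T j j) * x k)"
    using Tx[of i] i by simp
qed

text \<open>Eliminating j turns \<open>T U\<close> into \<open>T V\<close>, where V adds U_ij U_jk /
  t to U. The pivot is t = (1 + s_j) (1 - w), so 1 / t and hence V stay in the class. The induction
  has to range over all U: even for constant entries at the start, later blocks depend on s. The
  certificate x is the same at every stage.\<close>

lemma geom_class_det:
  fixes U :: "'n::finite \<Rightarrow> 'n \<Rightarrow> real ^ 'n \<Rightarrow> real"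
  defines "T \<equiv> \<lambda>U s i k. (if i = k then 1 + s $ i else 0) - U i k s"
  assumes \<alpha>: "0 < \<alpha>"
    and "\<And>i k. geom_class (U i k)"
    and x: "\<And>i. 0 < x i"
    and "\<And>s i. 0 \<le> s \<Longrightarrow> i \<in> J \<Longrightarrow> 0 < (\<Sum>k\<in>J. T U s i k * x k)"
  shows "(\<forall>s\<ge>0. 0 < det (principal_block J (T U s))) \<and>
    geom_class (\<lambda>s. (\<Prod>i\<in>J. (1 + s $ i) powr \<alpha>) * det (principal_block J (T U s)) powr (- \<alpha>))"
  using finite[of J] assms(3,5)
proof (induction J arbitrary: U rule: finite_induct)
  case empty
  have "principal_block {} (T U s) = mat 1" for s
    by (simp add: principal_block_def mat_def)
  then show ?case by (simp add: geom_class_const)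
next
  case (insert j J)
  have Unn: "0 \<le> U i k s" if "0 \<le> s" for i k s
    using geom_class_nonneg[OF insert.prems(1) that] .
  define t where "t s = T U s j j" for s
  define w where "w s = U j j s * inverse (1 + s $ j)" for s
  define V where "V i k s = U i k s + U i j s * U j k s * (inverse (1 + s $ j) * (1 - w s) powr (-1))" for i k s
  have off: "T U s i k \<le> 0" if "0 \<le> s" "i \<noteq> k" for s i k
    using Unn[OF that(1)] that by (simp add: T_def)
  have tpos: "0 < t s" if "0 \<le> s" for s
    unfolding t_def
    by (rule Schur_dominance(1)[OF insert.hyps, of "T U s" x]) (use off insert.prems x that in auto)
  have sj: "0 < 1 + s $ j" if "0 \<le> s" for s :: "real ^ 'n"
    using that by (simp add: vec_nonneg_iff add_pos_nonneg)
  have tw: "t s = (1 + s $ j) * (1 - w s)" if "0 \<le> s" for s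
    using sj[OF that] by (simp add: t_def T_def w_def field_simps)
  have w1: "w s < 1" if "0 \<le> s" for s
    using tpos[OF that] sj[OF that] unfolding tw[OF that] by (simp add: zero_less_mult_iff)
  have wG: "geom_class w"
    unfolding w_def by (intro geom_class_mult insert.prems geom_class_var)
  have VG: "geom_class (V i k)" for i k
    unfolding V_def
    by (intro geom_class_add geom_class_mult insert.prems geom_class_var geom_class_binomial wG w1) auto
  have TV: "T V s i k = T U s i k - T U s i j * T U s j k / T U s j j"
    if "0 \<le> s" "i \<in> J" "k \<in> J" for s i k
  proof -
    have "i \<noteq> j" "k \<noteq> j" using that insert.hyps by auto
    then show ?thesis
      unfolding t_def[symmetric] tw[OF that(1)] using w1[OF that(1)] sj[OF that(1)]
      by (simp add: T_def V_def powr_minus divide_inverse mult_ac)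
  qed
  have IH: "(\<forall>s\<ge>0. 0 < det (principal_block J (T V s))) \<and>
    geom_class (\<lambda>s. (\<Prod>i\<in>J. (1 + s $ i) powr \<alpha>) * det (principal_block J (T V s)) powr (- \<alpha>))"
  proof (rule insert.IH[OF VG])
    fix s :: "real ^ 'n" and i assume s: "0 \<le> s" and i: "i \<in> J"
    have "0 < (\<Sum>k\<in>J. (T U s i k - T U s i j * T U s j k / T U s j j) * x k)"
      by (rule Schur_dominance(2)[OF insert.hyps _ _ _ i]) (use off insert.prems x s in auto)
    also have "\<dots> = (\<Sum>k\<in>J. T V s i k * x k)"
      by (rule sum.cong) (simp_all add: TV s i)
    finally show "0 < (\<Sum>k\<in>J. T V s i k * x k)" .
  qed
  have det: "det (principal_block (insert j J) (T U s)) = t s * det (principal_block J (T V s))"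
    if "0 \<le> s" for s
  proof -
    have "principal_block J (T V s)
      = principal_block J (\<lambda>i k. T U s i k - T U s i j * T U s j k / T U s j j)"
      by (auto simp: principal_block_def vec_eq_iff TV that)
    then show ?thesis
      using det_principal_block_insert[OF insert.hyps(2), of "T U s"] tpos[OF that] by (simp add: t_def)
  qed
  show ?case
  proof
    show "\<forall>s\<ge>0. 0 < det (principal_block (insert j J) (T U s))"
      using IH tpos by (simp add: det)
    show "geom_class (\<lambda>s. (\<Prod>i\<in>insert j J. (1 + s $ i) powr \<alpha>) *
      det (principal_block (insert j J) (T U s)) powr (- \<alpha>))"
    proof (rule geom_class_cong)
      show "geom_class (\<lambda>s. (1 - w s) powr (- \<alpha>) *
        ((\<Prod>i\<in>J. (1 + s $ i) powr \<alpha>) * det (principal_block J (T V s)) powr (- \<alpha>)))"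
        by (intro geom_class_mult[OF _ conjunct2[OF IH]] geom_class_binomial wG w1 \<alpha>)
      fix s :: "real ^ 'n" assume s: "0 \<le> s"
      have "det (principal_block (insert j J) (T U s)) powr (- \<alpha>) =
        (1 + s $ j) powr (- \<alpha>) * (1 - w s) powr (- \<alpha>) * det (principal_block J (T V s)) powr (- \<alpha>)"
        unfolding det[OF s] tw[OF s] using IH sj[OF s] w1[OF s] s
        by (simp add: powr_mult)
      moreover have "(1 + s $ j) powr \<alpha> * (1 + s $ j) powr (- \<alpha>) = 1"
        using sj[OF s] by (simp flip: powr_add)
      ultimately show "(\<Prod>i\<in>insert j J. (1 + s $ i) powr \<alpha>) *
          det (principal_block (insert j J) (T U s)) powr (- \<alpha>) =
        (1 - w s) powr (- \<alpha>) *
        ((\<Prod>i\<in>J. (1 + s $ i) powr \<alpha>) * det (principal_block J (T V s)) powr (- \<alpha>))"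
        using insert.hyps by (simp add: mult_ac)
    qed
  qed
qed

section \<open>Uniqueness of the multivariate Laplace transform\<close>

lemma borel_measurable_vec_nth [measurable]: "(\<lambda>x :: real ^ 'n. x $ i) \<in> borel_measurable borel"
  by (intro borel_measurable_continuous_onI continuous_intros)

lemma borel_measurable_vec_lambda [measurable]:
  fixes f :: "'a \<Rightarrow> 'n::finite \<Rightarrow> real"
  assumes "\<And>i. (\<lambda>x. f x i) \<in> borel_measurable M"
  shows "(\<lambda>x. \<chi> i. f x i) \<in> borel_measurable M"
  by (subst borel_measurable_euclidean_space) (auto simp: Basis_vec_def inner_axis assms)

locale laplace_pair =
  fixes \<mu> \<nu> :: "(real ^ 'n) measure"
  assumes fin: "finite_measure \<mu>" "finite_measure \<nu>"
    and sets [measurable_cong, simp]: "sets \<mu> = sets borel" "sets \<nu> = sets borel"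
    and nonneg: "AE x in \<mu>. 0 \<le> x" "AE x in \<nu>. 0 \<le> x"
    and laplace: "\<And>s. 0 \<le> s \<Longrightarrow> (\<integral>\<^sup>+x. ennreal (exp (- (\<Sum>i\<in>UNIV. s $ i * x $ i))) \<partial>\<mu>)
      = (\<integral>\<^sup>+x. ennreal (exp (- (\<Sum>i\<in>UNIV. s $ i * x $ i))) \<partial>\<nu>)"
begin

text \<open>The substitution y_i = exp (- x_i) sends the orthant into the unit cube and turns
  Laplace transforms at integer points into moments. On the compact cube, polynomials are uniformly
  dense among continuous functions.\<close>

definition E :: "real ^ 'n \<Rightarrow> real ^ 'n" where "E x = (\<chi> i. exp (- x $ i))"

definition same_integral :: "(real ^ 'n \<Rightarrow> real) \<Rightarrow> bool" where
  "same_integral g \<longleftrightarrow> (\<integral>x. g (E x) \<partial>\<mu>) = (\<integral>x. g (E x) \<partial>\<nu>)"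

lemma E_measurable [measurable]: "E \<in> borel_measurable borel"
  unfolding E_def by measurable

lemma E_in_cube: "0 \<le> x \<Longrightarrow> E x \<in> cbox 0 1"
  by (simp add: E_def mem_box_cart less_eq_vec_def)

lemma integrable_E:
  fixes g :: "real ^ 'n \<Rightarrow> real"
  assumes "continuous_on UNIV g"
  shows "integrable \<mu> (\<lambda>x. g (E x))" "integrable \<nu> (\<lambda>x. g (E x))"
proof -
  have "bounded (g ` cbox 0 1)"
    using assms by (intro compact_imp_bounded compact_continuous_image compact_cbox)
      (auto intro: continuous_on_subset)
  then obtain B where B: "\<And>y. y \<in> cbox 0 1 \<Longrightarrow> \<bar>g y\<bar> \<le> B"
    unfolding bounded_iff real_norm_def by blast
  have [measurable]: "g \<in> borel_measurable borel"
    using assms by (rule borel_measurable_continuous_onI)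
  show "integrable \<mu> (\<lambda>x. g (E x))"
    by (rule finite_measure.integrable_const_bound[OF fin(1), where B = B])
       (use nonneg(1) in \<open>auto elim!: eventually_mono intro: B E_in_cube\<close>)
  show "integrable \<nu> (\<lambda>x. g (E x))"
    by (rule finite_measure.integrable_const_bound[OF fin(2), where B = B])
       (use nonneg(2) in \<open>auto elim!: eventually_mono intro: B E_in_cube\<close>)
qed

text \<open>Agreement is required against all monomials at once, so that the class is closed under
  multiplication by polynomials.\<close>

definition moment_stable :: "(real ^ 'n \<Rightarrow> real) \<Rightarrow> bool" where
  "moment_stable q \<longleftrightarrow> continuous_on UNIV q \<and> (\<forall>k. same_integral (\<lambda>y. q y * (\<Prod>i\<in>UNIV. y $ i ^ k i)))"

lemma moment_stable_1: "moment_stable (\<lambda>_. 1)"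
proof -
  have "same_integral (\<lambda>y. \<Prod>i\<in>UNIV. y $ i ^ k i)" for k
  proof -
    have "(\<Prod>i\<in>UNIV. E x $ i ^ k i) = exp (- (\<Sum>i\<in>UNIV. (\<chi> i. real (k i)) $ i * x $ i))" for x
      by (simp add: E_def exp_of_nat_mult[symmetric] exp_sum sum_negf[symmetric])
    then show ?thesis
      unfolding same_integral_def using laplace[of "\<chi> i. real (k i)"]
      by (simp add: integral_eq_nn_integral less_eq_vec_def)
  qed
  then show ?thesis by (simp add: moment_stable_def)
qed

lemma moment_stable_continuous:
  "moment_stable q \<Longrightarrow> continuous_on UNIV (\<lambda>y. q y * (\<Prod>i\<in>UNIV. y $ i ^ k i))"
  by (auto simp: moment_stable_def intro!: continuous_intros)

lemma moment_stable_add: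
  assumes "moment_stable p" "moment_stable q"
  shows "moment_stable (\<lambda>y. p y + q y)"
  using assms integrable_E[OF moment_stable_continuous[OF assms(1)]]
    integrable_E[OF moment_stable_continuous[OF assms(2)]]
  by (auto simp: moment_stable_def same_integral_def distrib_right intro!: continuous_on_add)

lemma moment_stable_cmult: "moment_stable q \<Longrightarrow> moment_stable (\<lambda>y. c * q y)"
  by (auto simp: moment_stable_def same_integral_def mult.assoc intro!: continuous_intros)

lemma moment_stable_coordinate:
  assumes "moment_stable q"
  shows "moment_stable (\<lambda>y. y $ j * q y)"
proof -
  have shift: "(\<Prod>i\<in>UNIV. y $ i ^ (k(j := Suc (k j))) i) = y $ j * (\<Prod>i\<in>UNIV. y $ i ^ k i)"
    for y :: "real ^ 'n" and k
  proof -
    have "(\<Prod>i\<in>UNIV - {j}. y $ i ^ (k(j := Suc (k j))) i) = (\<Prod>i\<in>UNIV - {j}. y $ i ^ k i)"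
      by (rule prod.cong) auto
    then show ?thesis by (simp add: prod.remove[of UNIV j])
  qed
  have "same_integral (\<lambda>y. y $ j * q y * (\<Prod>i\<in>UNIV. y $ i ^ k i))" for k
  proof -
    have "same_integral (\<lambda>y. q y * (\<Prod>i\<in>UNIV. y $ i ^ (k(j := Suc (k j))) i))"
      using assms unfolding moment_stable_def by blast
    then show ?thesis unfolding shift by (simp only: mult_ac)
  qed
  with assms show ?thesis
    by (auto simp: moment_stable_def intro!: continuous_intros)
qed

lemma moment_stable_sum:
  "finite I \<Longrightarrow> (\<And>i. i \<in> I \<Longrightarrow> moment_stable (f i)) \<Longrightarrow> moment_stable (\<lambda>y. \<Sum>i\<in>I. f i y)"
proof (induction I rule: finite_induct)
  case empty
  then show ?case using moment_stable_cmult[OF moment_stable_1, of 0] by simp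
qed (simp add: moment_stable_add)

lemma moment_stable_polynomial:
  "real_polynomial_function p \<Longrightarrow> moment_stable q \<Longrightarrow> moment_stable (\<lambda>y. p y * q y)"
proof (induction arbitrary: q rule: real_polynomial_function.induct)
  case (linear f)
  \<comment> \<open>Polynomial functions are generated by arbitrary linear functionals; coordinates
    reduce these to the multiplications by y_j already handled.\<close>
  have expand: "f y = (\<Sum>i\<in>UNIV. f (axis i 1) * y $ i)" for y
  proof -
    have "f y = f (\<Sum>i\<in>UNIV. (y $ i) *\<^sub>R axis i 1)"
      using basis_expansion[of y] by (simp add: scalar_mult_eq_scaleR)
    also have "\<dots> = (\<Sum>i\<in>UNIV. f (axis i 1) * y $ i)"
      using bounded_linear.linear[OF linear(1)] by (simp add: linear_sum linear_cmul mult.commute)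
    finally show ?thesis .
  qed
  have "(\<lambda>y. f y * q y) = (\<lambda>y. \<Sum>i\<in>UNIV. f (axis i 1) * (y $ i * q y))"
    by (subst expand) (simp add: sum_distrib_right mult.assoc)
  then show ?case
    by (simp add: moment_stable_sum moment_stable_cmult moment_stable_coordinate linear(2))
next
  case (const c)
  then show ?case by (rule moment_stable_cmult)
next
  case (add f g)
  then show ?case by (simp add: distrib_right moment_stable_add)
next
  case (mult f g)
  then show ?case by (simp add: mult.assoc)
qed

lemma same_integral_continuous:
  assumes g: "continuous_on UNIV g"
  shows "same_integral g"
proof -
  define m where "m = measure \<mu> (space \<mu>) + measure \<nu> (space \<nu>)"
  have "0 \<le> m" by (simp add: m_def)
  have bound: "\<bar>(\<integral>x. g (E x) \<partial>\<mu>) - (\<integral>x. g (E x) \<partial>\<nu>)\<bar> \<le> e * m" if e: "0 < e" for e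
  proof -
    obtain p where p: "real_polynomial_function p" and pg: "\<And>y. y \<in> cbox 0 1 \<Longrightarrow> \<bar>g y - p y\<bar> < e"
      using Stone_Weierstrass_real_polynomial_function[OF compact_cbox _ e] g
      by (metis continuous_on_subset subset_UNIV)
    have cp: "continuous_on UNIV p"
      using p by (simp add: continuous_real_polymonial_function continuous_at_imp_continuous_on)
    have "moment_stable p"
      using moment_stable_polynomial[OF p moment_stable_1] by simp
    then have "same_integral p"
      unfolding moment_stable_def by (auto dest!: spec[of _ "\<lambda>_. 0"])
    moreover have close: "\<bar>(\<integral>x. g (E x) \<partial>\<rho>) - (\<integral>x. p (E x) \<partial>\<rho>)\<bar> \<le> e * measure \<rho> (space \<rho>)"
      if \<rho>: "finite_measure \<rho>" "AE x in \<rho>. 0 \<le> x" "integrable \<rho> (\<lambda>x. g (E x))" "integrable \<rho> (\<lambda>x. p (E x))"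
      for \<rho>
    proof -
      interpret finite_measure \<rho> by fact
      have "\<bar>(\<integral>x. g (E x) \<partial>\<rho>) - (\<integral>x. p (E x) \<partial>\<rho>)\<bar> = \<bar>\<integral>x. g (E x) - p (E x) \<partial>\<rho>\<bar>"
        using \<rho> by simp
      also have "\<dots> \<le> (\<integral>x. \<bar>g (E x) - p (E x)\<bar> \<partial>\<rho>)"
        by (rule integral_abs_bound)
      also have "\<dots> \<le> (\<integral>x. e \<partial>\<rho>)"
        using \<rho>(2) by (intro integral_mono_AE integrable_abs Bochner_Integration.integrable_diff \<rho> integrable_const)
          (auto elim!: eventually_mono dest!: E_in_cube pg)
      finally show ?thesis by (simp add: mult.commute)
    qed
    ultimately show ?thesis
      using close[OF fin(1) nonneg(1) integrable_E(1)[OF g] integrable_E(1)[OF cp]]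
        close[OF fin(2) nonneg(2) integrable_E(2)[OF g] integrable_E(2)[OF cp]]
      unfolding same_integral_def m_def distrib_left by linarith
  qed
  have "\<bar>(\<integral>x. g (E x) \<partial>\<mu>) - (\<integral>x. g (E x) \<partial>\<nu>)\<bar> \<le> 0"
  proof (rule field_le_epsilon)
    fix e :: real assume "0 < e"
    \<comment> \<open>Division by m + 1 and not by m, since the total mass m may be 0.\<close>
    then have "e / (m + 1) * m \<le> e" using \<open>0 \<le> m\<close> by (simp add: field_simps)
    moreover have "0 < e / (m + 1)" using \<open>0 \<le> m\<close> \<open>0 < e\<close> by simp
    ultimately show "\<bar>(\<integral>x. g (E x) \<partial>\<mu>) - (\<integral>x. g (E x) \<partial>\<nu>)\<bar> \<le> 0 + e"
      using bound[of "e / (m + 1)"] by simp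
  qed
  then show ?thesis by (simp add: same_integral_def)
qed

lemma same_measure_atMost: "measure \<mu> {..t} = measure \<nu> {..t}"
proof -
  \<comment> \<open>Continuous approximations of the indicator: the factor for i is 1 where y_i >=
    exp (- t_i), that is x_i <= t_i, and 0 once y_i <= exp (- t_i) - 1/n.\<close>
  define g where
    "g n y = (\<Prod>i\<in>UNIV. max 0 (min 1 (1 + real n * (y $ i - exp (- t $ i)))))" for n and y :: "real ^ 'n"
  have cont: "continuous_on UNIV (g n)" for n
    unfolding g_def by (intro continuous_intros)
  have g_bound: "norm (g n y) \<le> 1" for n y
    unfolding g_def by (simp add: abs_prod) (intro prod_le_1, auto)
  have lim: "(\<lambda>n. g n (E x)) \<longlonglongrightarrow> indicator {..t} x" for x
  proof (cases "x \<le> t")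
    case True
    then have "g n (E x) = 1" for n
      unfolding g_def E_def by (intro prod.neutral) (auto simp: less_eq_vec_def)
    then show ?thesis using True by simp
  next
    case False
    then obtain i where i: "t $ i < x $ i"
      by (auto simp: less_eq_vec_def not_le)
    define d where "d = exp (- t $ i) - exp (- x $ i)"
    have d: "0 < d" using i by (simp add: d_def)
    obtain m :: nat where m: "1 / d < real m" using reals_Archimedean2 by blast
    have "g n (E x) = 0" if "m \<le> n" for n
    proof -
      have "1 \<le> real m * d" using m d by (simp add: field_simps)
      also have "\<dots> \<le> real n * d" using that d by (intro mult_right_mono) auto
      finally have "max 0 (min 1 (1 + real n * (E x $ i - exp (- t $ i)))) = 0"
        by (simp add: d_def E_def algebra_simps)
      then show ?thesis unfolding g_def by (intro prod_zero) auto
    qed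
    then have "eventually (\<lambda>n. g n (E x) = 0) sequentially"
      using eventually_sequentially by blast
    then show ?thesis using False by (simp add: tendsto_eventually)
  qed
  have [measurable]: "g n \<in> borel_measurable borel" for n
    using cont by (rule borel_measurable_continuous_onI)
  have conv: "(\<lambda>n. \<integral>x. g n (E x) \<partial>\<rho>) \<longlonglongrightarrow> measure \<rho> {..t}"
    if \<rho>: "finite_measure \<rho>" and [measurable_cong, simp]: "sets \<rho> = sets borel" for \<rho>
  proof -
    have "(\<lambda>n. \<integral>x. g n (E x) \<partial>\<rho>) \<longlonglongrightarrow> (\<integral>x. indicator {..t} x \<partial>\<rho>)"
      using finite_measure.integrable_const[OF \<rho>, of 1] g_bound lim
      by (intro integral_dominated_convergence[where w = "\<lambda>_. 1"]) auto
    then show ?thesis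
      using sets_eq_imp_space_eq[OF that(2)] by simp
  qed
  have "(\<lambda>n. \<integral>x. g n (E x) \<partial>\<mu>) = (\<lambda>n. \<integral>x. g n (E x) \<partial>\<nu>)"
    using same_integral_continuous[OF cont] by (simp add: same_integral_def)
  then show ?thesis
    using conv[OF fin(1) sets(1)] conv[OF fin(2) sets(2)] by (metis LIMSEQ_unique)
qed

lemma laplace_unique: "\<mu> = \<nu>"
proof (rule measure_eqI_generator_eq[where E = "range (\<lambda>a. {..a})" and \<Omega> = UNIV
      and A = "\<lambda>n. {..\<chi> i. real n}"])
  have "{..a} \<inter> {..b} = {..inf a b}" for a b :: "real ^ 'n"
    by auto
  then show "Int_stable (range (\<lambda>a :: real ^ 'n. {..a}))"
    by (auto simp: Int_stable_def)
  have "sets (borel :: (real ^ 'n) measure) = sigma_sets UNIV (range (\<lambda>a. {..a}))"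
    by (simp add: borel_eq_atMost)
  then show "sets \<mu> = sigma_sets UNIV (range (\<lambda>a. {..a}))" "sets \<nu> = sigma_sets UNIV (range (\<lambda>a. {..a}))"
    by simp_all
  show "emeasure \<mu> X = emeasure \<nu> X" if "X \<in> range (\<lambda>a. {..a})" for X
    using that same_measure_atMost
    by (auto simp: finite_measure.emeasure_eq_measure[OF fin(1)] finite_measure.emeasure_eq_measure[OF fin(2)])
  show "(\<Union>n. {..\<chi> i. real n}) = (UNIV :: (real ^ 'n) set)"
  proof safe
    fix x :: "real ^ 'n"
    obtain n :: nat where "(\<Sum>i\<in>UNIV. \<bar>x $ i\<bar>) < real n" using reals_Archimedean2 by blast
    then have "x $ i \<le> real n" for i
      using member_le_sum[of i UNIV "\<lambda>i. \<bar>x $ i\<bar>"] by auto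
    then show "x \<in> (\<Union>n. {..\<chi> i. real n})" by (auto simp: less_eq_vec_def)
  qed simp
  show "emeasure \<mu> {..\<chi> i. real n} \<noteq> \<infinity>" for n
    using fin(1) by (simp add: finite_measure.emeasure_eq_measure)
qed auto

end

section \<open>Harris' inequality\<close>

text \<open>This is (f y - f x) (g y - g x) >= 0, multiplied out and written without subtraction
  because the values may be infinite. The product \<open>d * e\<close> of the increments is the
  difference of the two sides.\<close>

lemma ennreal_rearrangement:
  fixes f g :: "'a::linorder \<Rightarrow> ennreal"
  assumes "mono f" "mono g"
  shows "f x * g y + f y * g x \<le> f x * g x + f y * g y"
proof -
  have *: "f x * g y + f y * g x \<le> f x * g x + f y * g y" if le: "x \<le> y" for x y
  proof -
    obtain d e where de: "f y = f x + d" "g y = g x + e"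
      using monoD[OF assms(1) le] monoD[OF assms(2) le] by (metis le_iff_add)
    have "f x * g x + f y * g y = f x * g y + f y * g x + d * e"
      unfolding de by (simp add: algebra_simps)
    then show ?thesis by simp
  qed
  show ?thesis
    using *[of x y] *[of y x] by (cases "x \<le> y") (simp_all add: add.commute)
qed

text \<open>Integrating the two-point rearrangement inequality over x and over an independent copy y
  gives twice the claim.\<close>

lemma chebyshev_nn_integral:
  fixes f g :: "real \<Rightarrow> ennreal"
  assumes "prob_space M" "mono f" "mono g"
    and [measurable]: "f \<in> borel_measurable M" "g \<in> borel_measurable M"
  shows "(\<integral>\<^sup>+x. f x \<partial>M) * (\<integral>\<^sup>+x. g x \<partial>M) \<le> (\<integral>\<^sup>+x. f x * g x \<partial>M)"
proof -
  interpret prob_space M by fact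
  let ?F = "\<integral>\<^sup>+x. f x \<partial>M" and ?G = "\<integral>\<^sup>+x. g x \<partial>M" and ?P = "\<integral>\<^sup>+x. f x * g x \<partial>M"
  have "?F * g y + f y * ?G \<le> ?P + f y * g y" for y
  proof -
    have "(\<integral>\<^sup>+x. f x * g y + f y * g x \<partial>M) \<le> (\<integral>\<^sup>+x. f x * g x + f y * g y \<partial>M)"
      by (intro nn_integral_mono ennreal_rearrangement assms)
    then show ?thesis
      by (simp add: nn_integral_add nn_integral_cmult nn_integral_multc emeasure_space_1)
  qed
  then have "(\<integral>\<^sup>+y. ?F * g y + f y * ?G \<partial>M) \<le> (\<integral>\<^sup>+y. ?P + f y * g y \<partial>M)"
    by (intro nn_integral_mono)
  then have "2 * (?F * ?G) \<le> 2 * ?P"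
    by (simp add: nn_integral_add nn_integral_cmult nn_integral_multc emeasure_space_1 mult_2)
  then show ?thesis by (simp add: ennreal_mult_le_mult_iff)
qed

text \<open>Integrating out one coordinate preserves monotonicity. The induction hypothesis applies
  to the integrated functions \<open>f1\<close>, and the one-dimensional Chebyshev inequality to the
  slices in the remaining coordinate.\<close>

lemma harris_PiM:
  fixes M :: "'i \<Rightarrow> real measure" and \<phi> h :: "('i \<Rightarrow> real) \<Rightarrow> ennreal"
  assumes M: "\<And>i. prob_space (M i)" and "finite I"
    and "\<phi> \<in> borel_measurable (PiM I M)" "h \<in> borel_measurable (PiM I M)" "mono \<phi>" "mono h"
  shows "(\<integral>\<^sup>+x. \<phi> x \<partial>PiM I M) * (\<integral>\<^sup>+x. h x \<partial>PiM I M) \<le> (\<integral>\<^sup>+x. \<phi> x * h x \<partial>PiM I M)"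
  using assms(2-)
proof (induction I arbitrary: \<phi> h rule: finite_induct)
  case empty
  then show ?case by (simp add: PiM_empty nn_integral_count_space_finite)
next
  case (insert i I)
  interpret product_sigma_finite M
    using M by (simp add: product_sigma_finite_def prob_space_imp_sigma_finite)
  interpret Mi: prob_space "M i" by (rule M)
  note [measurable] = insert.prems(1,2)
  have upd: "(\<lambda>(x, y). f (x(i := y))) \<in> borel_measurable (PiM I M \<Otimes>\<^sub>M M i)"
    if "f \<in> borel_measurable (PiM (insert i I) M)" for f :: "('i \<Rightarrow> real) \<Rightarrow> ennreal"
    using measurable_comp[OF measurable_add_dim that] by (simp add: comp_def case_prod_beta)
  define f1 where "f1 f x = (\<integral>\<^sup>+y. f (x(i := y)) \<partial>M i)" for f :: "('i \<Rightarrow> real) \<Rightarrow> ennreal" and x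
  have f1_measurable: "f1 f \<in> borel_measurable (PiM I M)" if "f \<in> borel_measurable (PiM (insert i I) M)" for f
    unfolding f1_def[abs_def] using upd[OF that] by (intro sigma_finite_measure.borel_measurable_nn_integral[OF sigma_finite_measures])
  have f1_mono: "mono (f1 f)" if "mono f" for f
    unfolding f1_def by (intro monoI nn_integral_mono monoD[OF that]) (simp add: le_fun_def)
  have slice_mono: "mono (\<lambda>y. f (x(i := y)))" if "mono f" for f :: "('i \<Rightarrow> real) \<Rightarrow> ennreal" and x
    by (intro monoI monoD[OF that]) (simp add: le_fun_def)
  have slice_measurable: "(\<lambda>y. f (x(i := y))) \<in> borel_measurable (M i)"
    if "f \<in> borel_measurable (PiM (insert i I) M)" "x \<in> space (PiM I M)" for f :: "('i \<Rightarrow> real) \<Rightarrow> ennreal" and x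
    using measurable_Pair2[OF upd[OF that(1)] that(2)] by simp
  have "(\<integral>\<^sup>+x. \<phi> x \<partial>PiM (insert i I) M) * (\<integral>\<^sup>+x. h x \<partial>PiM (insert i I) M) =
    (\<integral>\<^sup>+x. f1 \<phi> x \<partial>PiM I M) * (\<integral>\<^sup>+x. f1 h x \<partial>PiM I M)"
    by (simp add: product_nn_integral_insert[OF insert.hyps] f1_def)
  also have "\<dots> \<le> (\<integral>\<^sup>+x. f1 \<phi> x * f1 h x \<partial>PiM I M)"
    using insert.prems by (intro insert.IH f1_measurable f1_mono)
  also have "\<dots> \<le> (\<integral>\<^sup>+x. f1 (\<lambda>x. \<phi> x * h x) x \<partial>PiM I M)"
    unfolding f1_def using insert.prems
    by (intro nn_integral_mono chebyshev_nn_integral M slice_mono slice_measurable)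
  also have "\<dots> = (\<integral>\<^sup>+x. \<phi> x * h x \<partial>PiM (insert i I) M)"
    by (simp add: product_nn_integral_insert[OF insert.hyps] f1_def)
  finally show ?case .
qed

lemma harris_indep_vars:
  fixes \<xi> :: "'n::finite \<Rightarrow> 'b \<Rightarrow> real" and \<phi> h :: "real ^ 'n \<Rightarrow> ennreal"
  assumes N: "prob_space N" "prob_space.indep_vars N (\<lambda>_. borel) \<xi> UNIV"
    and [measurable]: "\<phi> \<in> borel_measurable borel" "h \<in> borel_measurable borel"
    and mono: "mono \<phi>" "mono h"
  shows "(\<integral>\<^sup>+\<omega>. \<phi> (\<chi> i. \<xi> i \<omega>) \<partial>N) * (\<integral>\<^sup>+\<omega>. h (\<chi> i. \<xi> i \<omega>) \<partial>N)
    \<le> (\<integral>\<^sup>+\<omega>. \<phi> (\<chi> i. \<xi> i \<omega>) * h (\<chi> i. \<xi> i \<omega>) \<partial>N)"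
proof -
  interpret prob_space N by fact
  let ?D = "\<lambda>i. distr N borel (\<xi> i)"
  have [measurable]: "\<xi> i \<in> borel_measurable N" for i
    using N(2) by (simp add: indep_vars_def2)
  have T: "(\<lambda>\<omega> i. \<xi> i \<omega>) \<in> measurable N (PiM UNIV (\<lambda>_. borel))"
    by (rule measurable_PiM_single') auto
  have D: "distr N (PiM UNIV (\<lambda>_. borel)) (\<lambda>\<omega> i. \<xi> i \<omega>) = PiM UNIV ?D"
    using N(2) indep_vars_iff_distr_eq_PiM[where I = UNIV and M' = "\<lambda>_. borel" and X = \<xi>] by (simp add: restrict_UNIV)
  have meas: "(\<lambda>x. f (\<chi> i. x i)) \<in> borel_measurable (PiM UNIV (\<lambda>_. borel))"
    if [measurable]: "f \<in> borel_measurable borel" for f :: "real ^ 'n \<Rightarrow> ennreal"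
    by measurable
  have sets: "sets (PiM UNIV ?D) = sets (PiM UNIV (\<lambda>_. borel))"
    by (intro sets_PiM_cong) auto
  have "(\<integral>\<^sup>+x. \<phi> (\<chi> i. x i) \<partial>PiM UNIV ?D) * (\<integral>\<^sup>+x. h (\<chi> i. x i) \<partial>PiM UNIV ?D)
    \<le> (\<integral>\<^sup>+x. \<phi> (\<chi> i. x i) * h (\<chi> i. x i) \<partial>PiM UNIV ?D)"
    using meas mono by (intro harris_PiM prob_space_distr)
      (auto simp: measurable_cong_sets[OF sets refl] less_eq_vec_def le_fun_def intro!: monoI monoD[OF mono(1)] monoD[OF mono(2)])
  then show ?thesis
    unfolding D[symmetric] by (simp add: nn_integral_distr[OF T] meas)
qed

section \<open>Moments of the exponentially tilted gamma law\<close>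

text \<open>Substituting t = (1 + s) x in the Euler integral for
  \<open>Gamma (\<alpha> + k)\<close>. The case k = 0 is the Laplace transform of the gamma law; a
  larger k shows that the weight x^k produces k further factors 1 / (1 + s).\<close>

lemma gamma_density_moment:
  fixes s :: real
  assumes Z: "gamma_distributed N \<alpha> 1 Z" and \<alpha>: "0 < \<alpha>" and s: "0 \<le> s"
  shows "(\<integral>\<^sup>+\<omega>. ennreal (Z \<omega>) ^ k * ennreal (exp (- s * Z \<omega>)) \<partial>N)
    = ennreal (Gamma (\<alpha> + k) / Gamma \<alpha> * (1 + s) powr (- (\<alpha> + k)))"
proof -
  define \<beta> where "\<beta> = \<alpha> + k"
  define c where "c = 1 + s"
  define f where "f t = indicator {0..} t * t powr (\<beta> - 1) / exp t" for t :: real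
  have c: "0 < c" and \<beta>: "0 < \<beta>" using \<alpha> s by (auto simp: c_def \<beta>_def)
  have [measurable]: "f \<in> borel_measurable borel" unfolding f_def[abs_def] by measurable
  have f_nonneg: "0 \<le> f t" for t by (simp add: f_def)
  have "ennreal (Gamma \<beta>) = ennreal c * (\<integral>\<^sup>+x. ennreal (f (c * x)) \<partial>lborel)"
    using Gamma_conv_nn_integral_real[OF \<beta>] nn_integral_real_affine[of "\<lambda>x. ennreal (f x)" c 0] c
    by (simp add: f_def)
  then have "ennreal (1 / c) * ennreal (Gamma \<beta>) = ennreal (1 / c) * ennreal c * (\<integral>\<^sup>+x. ennreal (f (c * x)) \<partial>lborel)"
    by (simp add: mult.assoc)
  then have I: "(\<integral>\<^sup>+x. ennreal (f (c * x)) \<partial>lborel) = ennreal (Gamma \<beta> / c)"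
    using c \<beta> by (simp flip: ennreal_mult)
  have "(\<integral>\<^sup>+\<omega>. ennreal (Z \<omega>) ^ k * ennreal (exp (- s * Z \<omega>)) \<partial>N) =
    (\<integral>\<^sup>+x. ennreal (gamma_density \<alpha> 1 x) * (ennreal x ^ k * ennreal (exp (- s * x))) \<partial>lborel)"
    using Z unfolding gamma_distributed_def by (intro distributed_nn_integral[symmetric]) auto
  also have "\<dots> = (\<integral>\<^sup>+x. ennreal (c powr (1 - \<beta>) / Gamma \<alpha>) * ennreal (f (c * x)) \<partial>lborel)"
  proof (intro nn_integral_cong)
    fix x :: real
    show "ennreal (gamma_density \<alpha> 1 x) * (ennreal x ^ k * ennreal (exp (- s * x))) =
      ennreal (c powr (1 - \<beta>) / Gamma \<alpha>) * ennreal (f (c * x))"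
    proof (cases "0 < x")
      case True
      have 1: "x powr (\<alpha> - 1) * x ^ k = x powr (\<beta> - 1)"
        using True by (simp add: \<beta>_def powr_realpow[symmetric] powr_add[symmetric] algebra_simps)
      have 2: "exp (- x) * exp (- s * x) = 1 / exp (c * x)"
        by (simp add: c_def exp_minus exp_add algebra_simps inverse_eq_divide)
      have 3: "c powr (1 - \<beta>) * (c * x) powr (\<beta> - 1) = x powr (\<beta> - 1)"
        using c True by (simp add: powr_mult flip: powr_add mult.assoc)
      have "gamma_density \<alpha> 1 x * (x ^ k * exp (- s * x)) =
        (x powr (\<alpha> - 1) * x ^ k) * (exp (- x) * exp (- s * x)) / Gamma \<alpha>"
        using True by (simp add: gamma_density_def)
      also have "\<dots> = (c powr (1 - \<beta>) * (c * x) powr (\<beta> - 1)) * (1 / exp (c * x)) / Gamma \<alpha>"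
        unfolding 1 2 3 ..
      also have "\<dots> = c powr (1 - \<beta>) / Gamma \<alpha> * f (c * x)"
        using True c by (simp add: f_def)
      finally have "gamma_density \<alpha> 1 x * (x ^ k * exp (- s * x)) = c powr (1 - \<beta>) / Gamma \<alpha> * f (c * x)" .
      then show ?thesis
        using True c \<alpha> f_nonneg
        by (simp add: gamma_density_def ennreal_power flip: ennreal_mult)
    next
      case False
      \<comment> \<open>At x = 0 both sides vanish for every exponent, since \<open>0 powr r\<close>
        is 0.\<close>
      then show ?thesis
        using c by (cases "x = 0") (auto simp: gamma_density_def f_def indicator_def mult_le_0_iff zero_le_mult_iff)
    qed
  qed
  also have "\<dots> = ennreal (c powr (1 - \<beta>) / Gamma \<alpha>) * ennreal (Gamma \<beta> / c)"
    by (simp add: nn_integral_cmult I)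
  also have "\<dots> = ennreal (Gamma \<beta> / Gamma \<alpha> * c powr (- \<beta>))"
    using c \<alpha> \<beta> by (simp add: powr_diff powr_minus flip: ennreal_mult) (simp add: field_simps)
  finally show ?thesis by (simp add: \<beta>_def c_def)
qed

section \<open>Vectors of independent gamma variables\<close>

locale gamma_vector = prob_space N for N :: "'b measure" +
  fixes \<alpha> :: real and \<xi> :: "'n::finite \<Rightarrow> 'b \<Rightarrow> real"
  assumes \<alpha>_pos: "0 < \<alpha>"
    and indep: "indep_vars (\<lambda>_. borel) \<xi> UNIV"
    and gamma: "\<And>i. gamma_distributed N \<alpha> 1 (\<xi> i)"
begin

definition G :: "'b \<Rightarrow> real ^ 'n" where "G \<omega> = (\<chi> i. \<xi> i \<omega>)"

lemma \<xi>_measurable [measurable]: "\<xi> i \<in> borel_measurable N"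
  using indep by (simp add: indep_vars_def2)

lemma G_measurable [measurable]: "G \<in> borel_measurable N"
  unfolding G_def by measurable

lemma AE_G_pos: "AE \<omega> in N. \<forall>i. 0 < G \<omega> $ i"
proof -
  have "AE \<omega> in N. 0 < \<xi> i \<omega>" for i
    using distributed_AE2[OF gamma[of i, unfolded gamma_distributed_def], of "\<lambda>x. 0 < x"]
    by (simp add: gamma_density_def)
  then show ?thesis by (simp add: G_def AE_all_countable)
qed

lemma laplace_monomial:
  assumes s: "0 \<le> s"
  shows "(\<integral>\<^sup>+\<omega>. (\<Prod>i\<in>UNIV. ennreal (G \<omega> $ i) ^ k i) * ennreal (exp (- (\<Sum>i\<in>UNIV. s $ i * G \<omega> $ i))) \<partial>N)
    = (\<Prod>i\<in>UNIV. ennreal (Gamma (\<alpha> + k i) / Gamma \<alpha> * (1 + s $ i) powr (- (\<alpha> + k i))))"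
proof -
  have "(\<integral>\<^sup>+\<omega>. (\<Prod>i\<in>UNIV. ennreal (G \<omega> $ i) ^ k i) * ennreal (exp (- (\<Sum>i\<in>UNIV. s $ i * G \<omega> $ i))) \<partial>N) =
    (\<integral>\<^sup>+\<omega>. (\<Prod>i\<in>UNIV. ennreal (\<xi> i \<omega>) ^ k i * ennreal (exp (- s $ i * \<xi> i \<omega>))) \<partial>N)"
    by (simp add: G_def prod.distrib prod_ennreal exp_sum sum_negf[symmetric])
  also have "\<dots> = (\<Prod>i\<in>UNIV. \<integral>\<^sup>+\<omega>. ennreal (\<xi> i \<omega>) ^ k i * ennreal (exp (- s $ i * \<xi> i \<omega>)) \<partial>N)"
    by (intro indep_vars_nn_integral indep_vars_compose2[OF indep,
          where Y = "\<lambda>i x. ennreal x ^ k i * ennreal (exp (- s $ i * x))"]) auto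
  also have "\<dots> = (\<Prod>i\<in>UNIV. ennreal (Gamma (\<alpha> + k i) / Gamma \<alpha> * (1 + s $ i) powr (- (\<alpha> + k i))))"
    using s by (intro prod.cong gamma_density_moment gamma \<alpha>_pos) (auto simp: vec_nonneg_iff)
  finally show ?thesis .
qed

text \<open>The density follows the construction of F: a monomial in 1 / (1 + s_i) comes from the
  same monomial in x, and a series from the series of densities, by monotone convergence.
  Nonnegative coefficients are what make h increasing.\<close>

lemma geom_class_density:
  assumes "geom_class F"
  obtains h :: "real ^ 'n \<Rightarrow> ennreal" where "h \<in> borel_measurable borel" "mono h"
    "\<And>s. 0 \<le> s \<Longrightarrow> (\<integral>\<^sup>+\<omega>. h (G \<omega>) * ennreal (exp (- (\<Sum>i\<in>UNIV. s $ i * G \<omega> $ i))) \<partial>N)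
      = ennreal (F s * (\<Prod>i\<in>UNIV. (1 + s $ i) powr (- \<alpha>)))"
proof -
  have "\<exists>h :: real ^ 'n \<Rightarrow> ennreal. h \<in> borel_measurable borel \<and> mono h \<and>
    (\<forall>s\<ge>0. (\<integral>\<^sup>+\<omega>. h (G \<omega>) * ennreal (exp (- (\<Sum>i\<in>UNIV. s $ i * G \<omega> $ i))) \<partial>N)
      = ennreal (F s * (\<Prod>i\<in>UNIV. (1 + s $ i) powr (- \<alpha>))))"
    using assms
  proof induction
    case (monomial c k)
    \<comment> \<open>Each factor is the reciprocal of the moment of order k_i of the gamma law,
      which normalizes the power of x_i.\<close>
    define C where "C = c * (\<Prod>i\<in>UNIV. Gamma \<alpha> / Gamma (\<alpha> + k i))"
    have Gpos: "0 < Gamma (\<alpha> + k i)" for i using \<alpha>_pos by simp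
    then have C: "0 \<le> C" unfolding C_def using monomial \<alpha>_pos
      by (intro mult_nonneg_nonneg prod_nonneg) (auto simp: less_imp_le)
    \<comment> \<open>As \<open>ennreal\<close> sends negative reals to 0, this h is increasing on
      the whole space and not just on the orthant.\<close>
    define h :: "real ^ 'n \<Rightarrow> ennreal" where "h x = ennreal C * (\<Prod>i\<in>UNIV. ennreal (x $ i) ^ k i)" for x
    have "h \<in> borel_measurable borel" unfolding h_def[abs_def] by measurable
    moreover have "mono h"
      unfolding h_def
      by (intro monoI mult_left_mono prod_mono_ennreal power_mono ennreal_leI) (auto simp: less_eq_vec_def)
    moreover have "(\<integral>\<^sup>+\<omega>. h (G \<omega>) * ennreal (exp (- (\<Sum>i\<in>UNIV. s $ i * G \<omega> $ i))) \<partial>N)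
      = ennreal (c * (\<Prod>i\<in>UNIV. inverse (1 + s $ i) ^ k i) * (\<Prod>i\<in>UNIV. (1 + s $ i) powr (- \<alpha>)))"
      if s: "0 \<le> s" for s
    proof -
      have si: "0 < 1 + s $ i" for i using s by (simp add: vec_nonneg_iff add_pos_nonneg)
      have eq: "Gamma \<alpha> / Gamma (\<alpha> + k i) * (Gamma (\<alpha> + k i) / Gamma \<alpha> * (1 + s $ i) powr (- (\<alpha> + k i)))
        = inverse (1 + s $ i) ^ k i * (1 + s $ i) powr (- \<alpha>)" for i
      proof -
        have "Gamma \<alpha> \<noteq> 0" "Gamma (\<alpha> + k i) \<noteq> 0"
          using Gpos[of i] Gamma_real_pos[OF \<alpha>_pos] by linarith+
        moreover have "(1 + s $ i) powr (- (\<alpha> + k i)) = inverse (1 + s $ i) ^ k i * (1 + s $ i) powr (- \<alpha>)"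
          using si[of i] by (simp add: powr_diff powr_realpow power_inverse divide_inverse mult.commute)
        ultimately show ?thesis by simp
      qed
      have "(\<integral>\<^sup>+\<omega>. h (G \<omega>) * ennreal (exp (- (\<Sum>i\<in>UNIV. s $ i * G \<omega> $ i))) \<partial>N) =
        ennreal C * ennreal (\<Prod>i\<in>UNIV. Gamma (\<alpha> + k i) / Gamma \<alpha> * (1 + s $ i) powr (- (\<alpha> + k i)))"
        using laplace_monomial[OF s, of k] Gpos \<alpha>_pos
        by (simp add: h_def mult.assoc nn_integral_cmult prod_ennreal less_imp_le)
      also have "\<dots> = ennreal (C * (\<Prod>i\<in>UNIV. Gamma (\<alpha> + k i) / Gamma \<alpha> * (1 + s $ i) powr (- (\<alpha> + k i))))"
        using C by (simp add: ennreal_mult')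
      also have "C * (\<Prod>i\<in>UNIV. Gamma (\<alpha> + k i) / Gamma \<alpha> * (1 + s $ i) powr (- (\<alpha> + k i)))
        = c * (\<Prod>i\<in>UNIV. inverse (1 + s $ i) ^ k i * (1 + s $ i) powr (- \<alpha>))"
        unfolding C_def mult.assoc prod.distrib[symmetric] eq ..
      finally show ?thesis by (simp add: prod.distrib mult.assoc)
    qed
    ultimately show ?case by blast
  next
    case (sums f F)
    from choice[OF allI[OF sums.IH]] obtain h :: "nat \<Rightarrow> real ^ 'n \<Rightarrow> ennreal" where
      H: "\<forall>n. h n \<in> borel_measurable borel \<and> mono (h n) \<and>
        (\<forall>s\<ge>0. (\<integral>\<^sup>+\<omega>. h n (G \<omega>) * ennreal (exp (- (\<Sum>i\<in>UNIV. s $ i * G \<omega> $ i))) \<partial>N)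
          = ennreal (f n s * (\<Prod>i\<in>UNIV. (1 + s $ i) powr (- \<alpha>))))" ..
    then have [measurable]: "h n \<in> borel_measurable borel" and mono: "mono (h n)" for n
      by simp_all
    have L: "(\<integral>\<^sup>+\<omega>. h n (G \<omega>) * ennreal (exp (- (\<Sum>i\<in>UNIV. s $ i * G \<omega> $ i))) \<partial>N)
      = ennreal (f n s * (\<Prod>i\<in>UNIV. (1 + s $ i) powr (- \<alpha>)))" if "0 \<le> s" for n s
      using H that by simp
    show ?case
    proof (intro exI[of _ "\<lambda>x. \<Sum>n. h n x"] conjI allI impI)
      show "(\<lambda>x. \<Sum>n. h n x) \<in> borel_measurable borel" by measurable
      show "mono (\<lambda>x. \<Sum>n. h n x)"
        using mono by (intro monoI suminf_le) (auto dest: monoD)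
      fix s :: "real ^ 'n" assume s: "0 \<le> s"
      let ?P = "\<Prod>i\<in>UNIV. (1 + s $ i) powr (- \<alpha>)"
      have "(\<integral>\<^sup>+\<omega>. (\<Sum>n. h n (G \<omega>)) * ennreal (exp (- (\<Sum>i\<in>UNIV. s $ i * G \<omega> $ i))) \<partial>N) =
        (\<integral>\<^sup>+\<omega>. (\<Sum>n. h n (G \<omega>) * ennreal (exp (- (\<Sum>i\<in>UNIV. s $ i * G \<omega> $ i)))) \<partial>N)"
        by simp
      also have "\<dots> = (\<Sum>n. ennreal (f n s * ?P))"
        by (subst nn_integral_suminf) (simp_all add: L s)
      also have "\<dots> = ennreal (F s * ?P)"
      proof (intro suminf_ennreal_eq sums_mult2 sums.hyps(2)[OF s])
        show "0 \<le> f n s * ?P" for n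
          using geom_class_nonneg[OF sums.hyps(1) s] by (intro mult_nonneg_nonneg prod_nonneg) auto
      qed
      finally show "(\<integral>\<^sup>+\<omega>. (\<Sum>n. h n (G \<omega>)) * ennreal (exp (- (\<Sum>i\<in>UNIV. s $ i * G \<omega> $ i))) \<partial>N)
        = ennreal (F s * ?P)" .
    qed
  qed
  then show ?thesis using that by blast
qed

lemma nn_integral_eq_of_laplace_eq:
  fixes Y :: "'a \<Rightarrow> real ^ 'n" and h :: "real ^ 'n \<Rightarrow> ennreal"
  assumes M: "prob_space M" and [measurable]: "Y \<in> borel_measurable M" "h \<in> borel_measurable borel"
    and Y: "AE \<omega> in M. 0 \<le> Y \<omega>"
    and L: "\<And>s. 0 \<le> s \<Longrightarrow> (\<integral>\<^sup>+\<omega>. ennreal (exp (- (\<Sum>i\<in>UNIV. s $ i * Y \<omega> $ i))) \<partial>M)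
      = (\<integral>\<^sup>+\<omega>. h (G \<omega>) * ennreal (exp (- (\<Sum>i\<in>UNIV. s $ i * G \<omega> $ i))) \<partial>N)"
    and [measurable]: "\<phi> \<in> borel_measurable borel"
  shows "(\<integral>\<^sup>+\<omega>. \<phi> (Y \<omega>) \<partial>M) = (\<integral>\<^sup>+\<omega>. h (G \<omega>) * \<phi> (G \<omega>) \<partial>N)"
proof -
  interpret M: prob_space M by fact
  let ?\<mu> = "distr M borel Y" and ?\<nu> = "density (distr N borel G) h"
  have \<nu>: "(\<integral>\<^sup>+x. f x \<partial>?\<nu>) = (\<integral>\<^sup>+\<omega>. h (G \<omega>) * f (G \<omega>) \<partial>N)" if [measurable]: "f \<in> borel_measurable borel" for f
    by (subst nn_integral_density) (simp_all add: nn_integral_distr)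
  have "AE x in distr N borel G. 0 \<le> x"
    using AE_G_pos by (subst AE_distr_iff) (auto simp: vec_nonneg_iff intro: less_imp_le)
  then have \<nu>_nonneg: "AE x in ?\<nu>. 0 \<le> x"
    by (subst AE_density) (auto elim: eventually_mono)
  \<comment> \<open>At s = 0 the equality of transforms says that the weighted law of
    \<open>G\<close> has the total mass of the law of \<open>Y\<close>.\<close>
  have "emeasure ?\<nu> (space ?\<nu>) = 1"
    using \<nu>[of "\<lambda>_. 1"] L[of 0] by (simp add: M.emeasure_space_1)
  then have fin_\<nu>: "finite_measure ?\<nu>" by (intro finite_measureI) simp
  have fin_\<mu>: "finite_measure ?\<mu>"
    using M.prob_space_distr[of Y borel] by (simp add: prob_space_def)
  have "laplace_pair ?\<mu> ?\<nu>"
  proof (rule laplace_pair.intro[OF fin_\<mu> fin_\<nu>])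
    show "AE x in ?\<mu>. 0 \<le> x" using Y by (subst AE_distr_iff) auto
    show "AE x in ?\<nu>. 0 \<le> x" by (rule \<nu>_nonneg)
    show "(\<integral>\<^sup>+x. ennreal (exp (- (\<Sum>i\<in>UNIV. s $ i * x $ i))) \<partial>?\<mu>)
      = (\<integral>\<^sup>+x. ennreal (exp (- (\<Sum>i\<in>UNIV. s $ i * x $ i))) \<partial>?\<nu>)" if "0 \<le> s" for s
      using L[OF that] by (subst \<nu>, simp, subst nn_integral_distr) simp_all
  qed simp_all
  then have "?\<mu> = ?\<nu>" by (rule laplace_pair.laplace_unique)
  then show ?thesis
    using \<nu>[of \<phi>] by (simp add: nn_integral_distr flip: \<open>?\<mu> = ?\<nu>\<close>)
qed

text \<open>Shrinking a gamma vector is an exponential tilt: since 1 + s/c = (1 + s + (c - 1)) / c,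
  the transform of G/c at s is a constant times that of G at s shifted by c - 1 in every
  coordinate.\<close>

lemma nn_integral_contraction:
  assumes c: "1 \<le> c" and [measurable]: "\<phi> \<in> borel_measurable borel"
  shows "(\<integral>\<^sup>+\<omega>. \<phi> (inverse c *\<^sub>R G \<omega>) \<partial>N) =
    (\<integral>\<^sup>+\<omega>. ennreal ((c powr \<alpha>) ^ CARD('n) * exp (- (c - 1) * (\<Sum>i\<in>UNIV. G \<omega> $ i))) * \<phi> (G \<omega>) \<partial>N)"
proof (rule nn_integral_eq_of_laplace_eq)
  show "AE \<omega> in N. 0 \<le> inverse c *\<^sub>R G \<omega>"
    using AE_G_pos c by (auto elim!: eventually_mono simp: vec_nonneg_iff intro: less_imp_le)
  fix s :: "real ^ 'n" assume s: "0 \<le> s"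
  define C where "C = (c powr \<alpha>) ^ CARD('n)"
  have LG: "(\<integral>\<^sup>+\<omega>. ennreal (exp (- (\<Sum>i\<in>UNIV. t $ i * G \<omega> $ i))) \<partial>N)
    = ennreal (\<Prod>i\<in>UNIV. (1 + t $ i) powr (- \<alpha>))" if "0 \<le> t" for t
    using laplace_monomial[OF that, of "\<lambda>_. 0"] Gamma_real_pos[OF \<alpha>_pos] by (simp add: prod_ennreal)
  have "(\<integral>\<^sup>+\<omega>. ennreal (exp (- (\<Sum>i\<in>UNIV. s $ i * (inverse c *\<^sub>R G \<omega>) $ i))) \<partial>N)
    = (\<integral>\<^sup>+\<omega>. ennreal (exp (- (\<Sum>i\<in>UNIV. (inverse c *\<^sub>R s) $ i * G \<omega> $ i))) \<partial>N)"
    by (simp add: mult_ac)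
  also have "\<dots> = ennreal (\<Prod>i\<in>UNIV. (1 + s $ i / c) powr (- \<alpha>))"
    using s c by (subst LG) (simp_all add: vec_nonneg_iff divide_inverse mult.commute)
  also have "(\<Prod>i\<in>UNIV. (1 + s $ i / c) powr (- \<alpha>)) = C * (\<Prod>i\<in>UNIV. (1 + (s $ i + (c - 1))) powr (- \<alpha>))"
  proof -
    have "(1 + s $ i / c) powr (- \<alpha>) = c powr \<alpha> * (1 + (s $ i + (c - 1))) powr (- \<alpha>)" for i
    proof -
      have "0 \<le> s $ i" using s by (simp add: vec_nonneg_iff)
      moreover have "1 + s $ i / c = (s $ i + c) / c" using c by (simp add: field_simps)
      ultimately show ?thesis using c by (simp add: powr_divide powr_minus field_simps)
    qed
    then show ?thesis by (simp add: C_def prod.distrib)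
  qed
  also have "ennreal \<dots> = ennreal C * (\<integral>\<^sup>+\<omega>. ennreal (exp (- (\<Sum>i\<in>UNIV. (s + (\<chi> i. c - 1)) $ i * G \<omega> $ i))) \<partial>N)"
    using s c by (subst LG) (simp_all add: C_def vec_nonneg_iff ennreal_mult')
  also have "\<dots> = (\<integral>\<^sup>+\<omega>. ennreal C * ennreal (exp (- (\<Sum>i\<in>UNIV. (s + (\<chi> i. c - 1)) $ i * G \<omega> $ i))) \<partial>N)"
    by (simp add: nn_integral_cmult)
  also have "\<dots> = (\<integral>\<^sup>+\<omega>. ennreal (C * exp (- (c - 1) * (\<Sum>i\<in>UNIV. G \<omega> $ i))) *
      ennreal (exp (- (\<Sum>i\<in>UNIV. s $ i * G \<omega> $ i))) \<partial>N)"
  proof (intro nn_integral_cong)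
    fix \<omega>
    have "(\<Sum>i\<in>UNIV. (s + (\<chi> i. c - 1)) $ i * G \<omega> $ i) =
      (c - 1) * (\<Sum>i\<in>UNIV. G \<omega> $ i) + (\<Sum>i\<in>UNIV. s $ i * G \<omega> $ i)"
      by (simp add: distrib_right sum.distrib sum_distrib_left)
    then have "- (\<Sum>i\<in>UNIV. (s + (\<chi> i. c - 1)) $ i * G \<omega> $ i) =
      - (c - 1) * (\<Sum>i\<in>UNIV. G \<omega> $ i) + - (\<Sum>i\<in>UNIV. s $ i * G \<omega> $ i)"
      by linarith
    then show "ennreal C * ennreal (exp (- (\<Sum>i\<in>UNIV. (s + (\<chi> i. c - 1)) $ i * G \<omega> $ i))) =
      ennreal (C * exp (- (c - 1) * (\<Sum>i\<in>UNIV. G \<omega> $ i))) *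
      ennreal (exp (- (\<Sum>i\<in>UNIV. s $ i * G \<omega> $ i)))"
      by (simp only: exp_add) (simp add: C_def mult.assoc flip: ennreal_mult)
  qed
  finally show "(\<integral>\<^sup>+\<omega>. ennreal (exp (- (\<Sum>i\<in>UNIV. s $ i * (inverse c *\<^sub>R G \<omega>) $ i))) \<partial>N) =
    (\<integral>\<^sup>+\<omega>. ennreal ((c powr \<alpha>) ^ CARD('n) * exp (- (c - 1) * (\<Sum>i\<in>UNIV. G \<omega> $ i))) *
      ennreal (exp (- (\<Sum>i\<in>UNIV. s $ i * G \<omega> $ i))) \<partial>N)"
    unfolding C_def .
qed (simp_all add: prob_space_axioms)

end

section \<open>Increasing functions that are not Borel measurable\<close>

text \<open>Strict inequality in every coordinate makes the superlevel sets unions of open sets, so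
  the result is Borel whatever \<phi> is. Where some coordinate of x is not positive, the supremum
  is empty and equals 0.\<close>

definition lower_regularization :: "(real ^ 'n \<Rightarrow> ennreal) \<Rightarrow> real ^ 'n \<Rightarrow> ennreal" where
  "lower_regularization \<phi> x = (SUP y\<in>{y. 0 \<le> y \<and> (\<forall>i. y $ i < x $ i)}. \<phi> y)"

lemma lower_regularization_mono: "mono (lower_regularization \<phi>)"
  unfolding lower_regularization_def
  by (intro monoI SUP_subset_mono) (auto simp: less_eq_vec_def intro: less_le_trans)

lemma lower_regularization_le:
  assumes "mono_on {x. 0 \<le> x} \<phi>" "0 \<le> x"
  shows "lower_regularization \<phi> x \<le> \<phi> x"
  unfolding lower_regularization_def using assms(2)
  by (intro SUP_least mono_onD[OF assms(1)]) (auto simp: less_eq_vec_def intro: less_imp_le)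

lemma le_lower_regularization: "0 \<le> y \<Longrightarrow> (\<And>i. y $ i < x $ i) \<Longrightarrow> \<phi> y \<le> lower_regularization \<phi> x"
  unfolding lower_regularization_def by (intro SUP_upper) auto

lemma lower_regularization_measurable [measurable]:
  "lower_regularization (\<phi> :: real ^ 'n \<Rightarrow> ennreal) \<in> borel_measurable borel"
proof (rule borel_measurableI_greater)
  fix t
  have "{x. t < lower_regularization \<phi> x} =
    (\<Union>y\<in>{y. 0 \<le> y \<and> t < \<phi> y}. \<Inter>i. {x. y $ i < x $ i})"
    by (auto simp: lower_regularization_def less_SUP_iff)
  moreover have "open (\<Inter>i. {x :: real ^ 'n. y $ i < x $ i})" for y :: "real ^ 'n"
    by (intro open_INT ballI open_Collect_less continuous_intros) auto
  ultimately have "open {x. t < lower_regularization \<phi> x}"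
    by auto
  then show "{x \<in> space borel. t < lower_regularization \<phi> x} \<in> sets borel"
    by simp
qed

context gamma_vector
begin

text \<open>For positive x and c > 1 the point x lies strictly below c x, so \<phi>(x) is at most
  the regularization at c x. It remains to undo the dilation: the law of G/c has a density with
  respect to that of G which tends to 1 as c decreases to 1, and \<open>w\<close> bounds it from
  below by an increasing sequence.\<close>

lemma nn_integral_le_lower_regularization:
  "(\<integral>\<^sup>+\<omega>. \<phi> (G \<omega>) \<partial>N) \<le> (\<integral>\<^sup>+\<omega>. lower_regularization \<phi> (G \<omega>) \<partial>N)"
proof -
  define c where "c n = 1 + 1 / real (Suc n)" for n
  have c: "1 < c n" for n by (simp add: c_def)
  define \<psi> where "\<psi> = lower_regularization \<phi>"
  have [measurable]: "\<psi> \<in> borel_measurable borel" by (simp add: \<psi>_def)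
  \<comment> \<open>One Borel function above \<phi> and below every dilate of \<psi>; the change of
    law requires measurability, so it is applied to \<open>u\<close> in place of \<phi>.\<close>
  define u where "u x = (INF n. \<psi> (c n *\<^sub>R x))" for x
  have [measurable]: "u \<in> borel_measurable borel" unfolding u_def[abs_def] by measurable
  \<comment> \<open>Here 1 / (n + 1) is \<open>c n - 1\<close>. The prefactor of the density is at
    least 1 and is dropped; the absolute value makes the sequence increasing in n also outside the
    orthant.\<close>
  define w where "w n x = ennreal (exp (- (1 / real (Suc n)) * \<bar>\<Sum>i\<in>UNIV. x $ i\<bar>))" for n and x :: "real ^ 'n"
  have [measurable]: "w n \<in> borel_measurable borel" for n unfolding w_def[abs_def] by measurable
  have w_mono: "incseq (\<lambda>n. w n x)" for x
    unfolding w_def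
    by (intro incseq_SucI ennreal_leI) (simp add: divide_inverse mult_right_mono)
  have "(\<lambda>n. exp (- (1 / real (Suc n)) * r)) \<longlonglongrightarrow> exp (- 0 * r)" for r :: real
    by (intro tendsto_intros LIMSEQ_Suc[OF lim_1_over_n])
  then have "(\<lambda>n. w n x) \<longlonglongrightarrow> ennreal 1" for x
    unfolding w_def by (intro tendsto_ennrealI) simp
  then have w_SUP: "(SUP n. w n x) = 1" for x
    using LIMSEQ_unique[OF LIMSEQ_SUP[OF w_mono]] by simp
  have "(\<integral>\<^sup>+\<omega>. \<phi> (G \<omega>) \<partial>N) \<le> (\<integral>\<^sup>+\<omega>. u (G \<omega>) \<partial>N)"
  proof (intro nn_integral_mono_AE eventually_mono[OF AE_G_pos])
    fix \<omega> assume "\<forall>i. 0 < G \<omega> $ i"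
    then show "\<phi> (G \<omega>) \<le> u (G \<omega>)"
      unfolding u_def \<psi>_def using c
      by (intro INF_greatest le_lower_regularization) (auto simp: vec_nonneg_iff intro: less_imp_le)
  qed
  also have "(\<integral>\<^sup>+\<omega>. u (G \<omega>) \<partial>N) = (\<integral>\<^sup>+\<omega>. (SUP n. u (G \<omega>) * w n (G \<omega>)) \<partial>N)"
    by (simp add: w_SUP flip: SUP_mult_left_ennreal)
  also have "\<dots> = (SUP n. \<integral>\<^sup>+\<omega>. u (G \<omega>) * w n (G \<omega>) \<partial>N)"
    using w_mono by (intro nn_integral_monotone_convergence_SUP) (auto simp: incseq_def le_fun_def intro!: mult_left_mono)
  also have "\<dots> \<le> (\<integral>\<^sup>+\<omega>. \<psi> (G \<omega>) \<partial>N)"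
  proof (rule SUP_least)
    fix n
    have "(\<integral>\<^sup>+\<omega>. u (G \<omega>) * w n (G \<omega>) \<partial>N) \<le>
      (\<integral>\<^sup>+\<omega>. ennreal ((c n powr \<alpha>) ^ CARD('n) * exp (- (c n - 1) * (\<Sum>i\<in>UNIV. G \<omega> $ i))) * u (G \<omega>) \<partial>N)"
    proof (intro nn_integral_mono)
      fix \<omega>
      let ?r = "\<Sum>i\<in>UNIV. G \<omega> $ i"
      have "1 * exp (- (1 / real (Suc n)) * \<bar>?r\<bar>) \<le> (c n powr \<alpha>) ^ CARD('n) * exp (- (c n - 1) * ?r)"
        using c[of n] \<alpha>_pos
        by (intro mult_mono one_le_power ge_one_powr_ge_zero) (auto simp: c_def divide_right_mono)
      then show "u (G \<omega>) * w n (G \<omega>) \<le>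
        ennreal ((c n powr \<alpha>) ^ CARD('n) * exp (- (c n - 1) * ?r)) * u (G \<omega>)"
        unfolding w_def mult.commute[of "u _"] by (intro mult_right_mono ennreal_leI) auto
    qed
    also have "\<dots> = (\<integral>\<^sup>+\<omega>. u (inverse (c n) *\<^sub>R G \<omega>) \<partial>N)"
      using c[of n] by (intro nn_integral_contraction[symmetric]) auto
    also have "\<dots> \<le> (\<integral>\<^sup>+\<omega>. \<psi> (G \<omega>) \<partial>N)"
    proof (intro nn_integral_mono)
      fix \<omega>
      have "u (inverse (c n) *\<^sub>R G \<omega>) \<le> \<psi> (c n *\<^sub>R inverse (c n) *\<^sub>R G \<omega>)"
        unfolding u_def by (rule INF_lower) simp
      then show "u (inverse (c n) *\<^sub>R G \<omega>) \<le> \<psi> (G \<omega>)" using c[of n] by simp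
    qed
    finally show "(\<integral>\<^sup>+\<omega>. u (G \<omega>) * w n (G \<omega>) \<partial>N) \<le> (\<integral>\<^sup>+\<omega>. \<psi> (G \<omega>) \<partial>N)" .
  qed
  finally show ?thesis by (simp add: \<psi>_def)
qed

text \<open>The regularization acts differently on the two sides: for \<open>G\<close> it costs
  nothing in the integral, and for \<open>Y\<close> it lies pointwise below \<phi>. Density and
  Harris inequality are thus applied to a Borel function only.\<close>

lemma stochastic_domination:
  fixes Y :: "'a \<Rightarrow> real ^ 'n"
  assumes M: "prob_space M" and [measurable]: "Y \<in> borel_measurable M" and Y: "AE \<omega> in M. 0 \<le> Y \<omega>"
    and F: "geom_class F"
    and L: "\<And>s. 0 \<le> s \<Longrightarrow> (\<integral>\<^sup>+\<omega>. ennreal (exp (- (\<Sum>i\<in>UNIV. s $ i * Y \<omega> $ i))) \<partial>M)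
      = ennreal (F s * (\<Prod>i\<in>UNIV. (1 + s $ i) powr (- \<alpha>)))"
    and \<phi>: "mono_on {x. 0 \<le> x} \<phi>"
  shows "(\<integral>\<^sup>+\<omega>. \<phi> (G \<omega>) \<partial>N) \<le> (\<integral>\<^sup>+\<omega>. \<phi> (Y \<omega>) \<partial>M)"
proof -
  interpret M: prob_space M by fact
  obtain h where h: "h \<in> borel_measurable borel" "mono h"
    and hL: "\<And>s. 0 \<le> s \<Longrightarrow> (\<integral>\<^sup>+\<omega>. h (G \<omega>) * ennreal (exp (- (\<Sum>i\<in>UNIV. s $ i * G \<omega> $ i))) \<partial>N)
      = ennreal (F s * (\<Prod>i\<in>UNIV. (1 + s $ i) powr (- \<alpha>)))"
    using geom_class_density[OF F] by blast
  have law: "(\<integral>\<^sup>+\<omega>. \<psi> (Y \<omega>) \<partial>M) = (\<integral>\<^sup>+\<omega>. h (G \<omega>) * \<psi> (G \<omega>) \<partial>N)"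
    if "\<psi> \<in> borel_measurable borel" for \<psi>
    by (rule nn_integral_eq_of_laplace_eq[OF M _ h(1) Y _ that]) (simp_all add: L hL)
  have "(\<integral>\<^sup>+\<omega>. h (G \<omega>) \<partial>N) = 1"
    using law[of "\<lambda>_. 1"] by (simp add: M.emeasure_space_1)
  let ?\<psi> = "lower_regularization \<phi>"
  have "(\<integral>\<^sup>+\<omega>. \<phi> (G \<omega>) \<partial>N) \<le> (\<integral>\<^sup>+\<omega>. ?\<psi> (G \<omega>) \<partial>N)"
    by (rule nn_integral_le_lower_regularization)
  also have "\<dots> = (\<integral>\<^sup>+\<omega>. h (G \<omega>) \<partial>N) * (\<integral>\<^sup>+\<omega>. ?\<psi> (G \<omega>) \<partial>N)"
    by (simp add: \<open>(\<integral>\<^sup>+\<omega>. h (G \<omega>) \<partial>N) = 1\<close>)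
  also have "\<dots> \<le> (\<integral>\<^sup>+\<omega>. h (G \<omega>) * ?\<psi> (G \<omega>) \<partial>N)"
    unfolding G_def
    by (rule harris_indep_vars[OF prob_space_axioms indep]) (auto intro: h lower_regularization_mono)
  also have "\<dots> = (\<integral>\<^sup>+\<omega>. ?\<psi> (Y \<omega>) \<partial>M)"
    by (simp add: law)
  also have "\<dots> \<le> (\<integral>\<^sup>+\<omega>. \<phi> (Y \<omega>) \<partial>M)"
    using Y by (intro nn_integral_mono_AE) (auto elim!: eventually_mono intro: lower_regularization_le[OF \<phi>])
  finally show ?thesis .
qed

end

section \<open>From nonnegative functions to extended expectations\<close>

lemma nn_integral_min_complement:
  assumes P: "prob_space P" and [measurable]: "g \<in> borel_measurable P"
  shows "(\<integral>\<^sup>+\<omega>. of_nat m - min (g \<omega>) (of_nat m) \<partial>P) + (\<integral>\<^sup>+\<omega>. min (g \<omega>) (of_nat m) \<partial>P) = of_nat m"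
proof -
  have "(of_nat m - min a (of_nat m)) + min a (of_nat m) = of_nat m" for a :: ennreal
    by (subst add.commute, subst add_diff_inverse_ennreal) auto
  moreover have "(\<integral>\<^sup>+\<omega>. (of_nat m - min (g \<omega>) (of_nat m)) + min (g \<omega>) (of_nat m) \<partial>P) =
    (\<integral>\<^sup>+\<omega>. of_nat m - min (g \<omega>) (of_nat m) \<partial>P) + (\<integral>\<^sup>+\<omega>. min (g \<omega>) (of_nat m) \<partial>P)"
    by (intro nn_integral_add) measurable
  ultimately show ?thesis
    using prob_space.emeasure_space_1[OF P] by simp
qed

lemma nn_integral_SUP_min:
  assumes [measurable]: "g \<in> borel_measurable P"
  shows "(\<integral>\<^sup>+\<omega>. g \<omega> \<partial>P) = (SUP m. \<integral>\<^sup>+\<omega>. min (g \<omega>) (of_nat m) \<partial>P)"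
proof -
  have "(SUP m. min a (of_nat m)) = a" for a :: ennreal
    using inf_SUP[of a "of_nat :: nat \<Rightarrow> ennreal" UNIV] by (simp add: ennreal_SUP_of_nat_eq_top inf_min)
  then have "(\<integral>\<^sup>+\<omega>. g \<omega> \<partial>P) = (\<integral>\<^sup>+\<omega>. (SUP m. min (g \<omega>) (of_nat m)) \<partial>P)"
    by simp
  also have "\<dots> = (SUP m. \<integral>\<^sup>+\<omega>. min (g \<omega>) (of_nat m) \<partial>P)"
    by (intro nn_integral_monotone_convergence_SUP)
      (auto simp: incseq_def le_fun_def intro: min.coboundedI2)
  finally show ?thesis .
qed

text \<open>The hypothesis \<open>dom\<close> concerns nonnegative increasing functions, while the
  negative part of f is decreasing. Its truncation at m, subtracted from m, is increasing and
  bounded, so finite integrals can be cancelled before m tends to infinity.\<close>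

lemma ext_expectation_mono:
  fixes f :: "'c::order \<Rightarrow> real"
  assumes M: "prob_space M" and N: "prob_space N"
    and dom: "\<And>\<phi> :: 'c \<Rightarrow> ennreal. mono_on S \<phi> \<Longrightarrow> (\<integral>\<^sup>+\<omega>. \<phi> (Z \<omega>) \<partial>N) \<le> (\<integral>\<^sup>+\<omega>. \<phi> (Y \<omega>) \<partial>M)"
    and f: "mono_on S f"
    and [measurable]: "(\<lambda>\<omega>. f (Y \<omega>)) \<in> borel_measurable M" "(\<lambda>\<omega>. f (Z \<omega>)) \<in> borel_measurable N"
  shows "ext_expectation N (\<lambda>\<omega>. f (Z \<omega>)) \<le> ext_expectation M (\<lambda>\<omega>. f (Y \<omega>))"
proof -
  have pos: "(\<integral>\<^sup>+\<omega>. ennreal (f (Z \<omega>)) \<partial>N) \<le> (\<integral>\<^sup>+\<omega>. ennreal (f (Y \<omega>)) \<partial>M)"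
    by (rule dom[of "\<lambda>x. ennreal (f x)"]) (auto intro!: mono_onI ennreal_leI dest: mono_onD[OF f])
  have "(\<integral>\<^sup>+\<omega>. min (ennreal (- f (Y \<omega>))) (of_nat m) \<partial>M) \<le> (\<integral>\<^sup>+\<omega>. min (ennreal (- f (Z \<omega>))) (of_nat m) \<partial>N)"
    for m
  proof -
    let ?\<phi> = "\<lambda>x. of_nat m - min (ennreal (- f x)) (of_nat m)"
    let ?a = "\<integral>\<^sup>+\<omega>. min (ennreal (- f (Y \<omega>))) (of_nat m) \<partial>M" and ?b = "\<integral>\<^sup>+\<omega>. ?\<phi> (Y \<omega>) \<partial>M"
    let ?c = "\<integral>\<^sup>+\<omega>. min (ennreal (- f (Z \<omega>))) (of_nat m) \<partial>N" and ?d = "\<integral>\<^sup>+\<omega>. ?\<phi> (Z \<omega>) \<partial>N"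
    have b: "?b + ?a = of_nat m" and d: "?d + ?c = of_nat m"
      by (rule nn_integral_min_complement; simp add: M N)+
    have "mono_on S ?\<phi>"
      by (intro mono_onI ennreal_minus_mono order_refl min.mono ennreal_leI) (auto dest: mono_onD[OF f])
    then have "?d + ?c \<le> ?b + ?c" by (intro add_right_mono dom)
    then have "?b + ?a \<le> ?b + ?c" by (simp only: b d)
    moreover have "?b \<noteq> \<top>"
    proof
      assume "?b = \<top>"
      with b have "of_nat m = (\<top> :: ennreal)" by simp
      then show False by simp
    qed
    ultimately show "?a \<le> ?c" by (simp add: ennreal_add_left_cancel_le)
  qed
  then have neg: "(\<integral>\<^sup>+\<omega>. ennreal (- f (Y \<omega>)) \<partial>M) \<le> (\<integral>\<^sup>+\<omega>. ennreal (- f (Z \<omega>)) \<partial>N)"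
    by (subst (1 2) nn_integral_SUP_min) (auto intro!: SUP_mono)
  show ?thesis
    unfolding ext_expectation_def using pos neg
    by (intro ereal_minus_mono) (simp_all add: less_eq_ennreal.rep_eq)
qed

section \<open>Permanental vectors\<close>

lemma matrix_inv_mult:
  fixes K :: "real ^ 'n ^ 'n"
  assumes "invertible K"
  shows "K ** matrix_inv K = mat 1" "matrix_inv K ** K = mat 1"
  using assms someI_ex[of "\<lambda>A'. K ** A' = mat 1 \<and> A' ** K = mat 1"]
  by (auto simp: invertible_def matrix_inv_def)

text \<open>The vector x consists of the row sums of the inverse, so A x is the all-ones vector. As
  off-diagonal terms are nonpositive, A_ii x_i >= 1, which makes both factors positive because x_i
  >= 0.\<close>

lemma M_matrix_dominance:
  fixes A K :: "real ^ 'n ^ 'n"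
  assumes A: "nonsingular_M_matrix A" and AK: "A ** K = mat 1"
  obtains x where "\<And>i. 0 < x i" "\<And>i. 0 < A $ i $ i" "\<And>i. (\<Sum>k\<in>UNIV. A $ i $ k * x k) = 1"
proof -
  have off: "A $ i $ k \<le> 0" if "i \<noteq> k" for i k
    using A that by (auto simp: nonsingular_M_matrix_def)
  have A_inv: "invertible A" and inv_nonneg: "0 \<le> matrix_inv A $ i $ j" for i j
    using A by (auto simp: nonsingular_M_matrix_def)
  have "matrix_inv A = matrix_inv A ** (A ** K)" by (simp add: AK)
  also have "\<dots> = K" by (simp add: matrix_mul_assoc matrix_inv_mult(2)[OF A_inv])
  finally have K: "0 \<le> K $ i $ j" for i j using inv_nonneg by simp
  define x where "x i = (\<Sum>j\<in>UNIV. K $ i $ j)" for i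
  have x: "0 \<le> x i" for i unfolding x_def by (intro sum_nonneg K)
  have Ax: "(\<Sum>k\<in>UNIV. A $ i $ k * x k) = 1" for i
  proof -
    have "(\<Sum>k\<in>UNIV. A $ i $ k * x k) = (\<Sum>j\<in>UNIV. \<Sum>k\<in>UNIV. A $ i $ k * K $ k $ j)"
      unfolding x_def sum_distrib_left by (rule sum.swap)
    also have "\<dots> = (\<Sum>j\<in>UNIV. (A ** K) $ i $ j)" by (simp add: matrix_matrix_mult_def)
    also have "\<dots> = 1" by (simp add: AK mat_def)
    finally show ?thesis .
  qed
  have "0 < A $ i $ i * x i" for i
  proof -
    have "(\<Sum>k\<in>UNIV - {i}. A $ i $ k * x k) \<le> 0"
      by (intro sum_nonpos mult_nonpos_nonneg x off) auto
    then show ?thesis using Ax[of i] by (simp add: sum.remove[of UNIV i])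
  qed
  then have "0 < A $ i $ i" "0 < x i" for i
    using x[of i] by (auto simp: zero_less_mult_iff) (meson less_le_not_le)+
  then show ?thesis using that Ax by blast
qed

text \<open>With S = diag (s_i a_i) one has I + K S = K (A + S), and dividing row i of A + S by a_i
  leaves unit diagonal plus s_i and the entries a_ik / a_i <= 0 off the diagonal. Rescaling the
  components by a_i is what makes 1 + s_i appear.\<close>

lemma permanental_laplace_geom_class:
  fixes K A :: "real ^ 'n ^ 'n"
  assumes \<alpha>: "0 < \<alpha>" and inv: "invertible K" and A_def: "A = matrix_inv K" and A: "nonsingular_M_matrix A"
  obtains F where "\<And>i. 0 < A $ i $ i" "geom_class F"
    "\<And>s. 0 \<le> s \<Longrightarrow> det (mat 1 + K ** diag_mat (\<chi> i. s $ i * A $ i $ i)) powr (- \<alpha>)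
      = F s * (\<Prod>i\<in>UNIV. (1 + s $ i) powr (- \<alpha>))"
proof -
  have KA: "K ** A = mat 1" "A ** K = mat 1" using matrix_inv_mult[OF inv] by (simp_all add: A_def)
  obtain x where x: "\<And>i. 0 < x i" and a: "\<And>i. 0 < A $ i $ i"
    and Ax: "\<And>i. (\<Sum>k\<in>UNIV. A $ i $ k * x k) = 1"
    using M_matrix_dominance[OF A KA(2)] by blast
  \<comment> \<open>These entries are constant in s, with zero diagonal; dependence on s arises only
    during the elimination.\<close>
  define U :: "'n \<Rightarrow> 'n \<Rightarrow> real ^ 'n \<Rightarrow> real"
    where "U i k s = (if i = k then 0 else - A $ i $ k / A $ i $ i)" for i k s
  define T where "T s i k = (if i = k then 1 + s $ i else 0) - U i k s" for s i k
  have T: "T s i k = (A $ i $ k + (if i = k then s $ i * A $ i $ i else 0)) / A $ i $ i" for s i k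
    using a[of i] by (cases "i = k") (simp_all add: T_def U_def field_simps)
  have U: "geom_class (U i k)" for i k
  proof -
    have "0 \<le> (if i = k then 0 else - A $ i $ k / A $ i $ i)"
      using A a[of i] by (auto simp: nonsingular_M_matrix_def divide_nonpos_pos)
    from geom_class_const[OF this] show ?thesis by (simp add: U_def[abs_def])
  qed
  have dom: "0 < (\<Sum>k\<in>UNIV. T s i k * x k)" if "0 \<le> s" for s i
  proof -
    have "(\<Sum>k\<in>UNIV. T s i k * x k) =
      ((\<Sum>k\<in>UNIV. A $ i $ k * x k) + (\<Sum>k\<in>UNIV. (if i = k then s $ i * A $ i $ i else 0) * x k)) / A $ i $ i"
      by (simp add: T distrib_right add_divide_distrib sum.distrib sum_divide_distrib)
    also have "(\<Sum>k\<in>UNIV. (if i = k then s $ i * A $ i $ i else 0) * x k) = s $ i * A $ i $ i * x i"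
      by (simp add: if_distrib[of "\<lambda>y. y * _"] cong: if_cong)
    finally have eq: "(\<Sum>k\<in>UNIV. T s i k * x k) = (1 + s $ i * A $ i $ i * x i) / A $ i $ i"
      by (simp only: Ax)
    have "0 \<le> s $ i * A $ i $ i * x i"
      using a[of i] x[of i] that by (simp add: vec_nonneg_iff)
    then show ?thesis
      unfolding eq using a[of i] by (intro divide_pos_pos add_pos_nonneg) auto
  qed
  define P where "P s = det (principal_block UNIV (T s))" for s
  have P: "\<forall>s\<ge>0. 0 < P s" and G: "geom_class (\<lambda>s. (\<Prod>i\<in>UNIV. (1 + s $ i) powr \<alpha>) * P s powr (- \<alpha>))"
    using geom_class_det[where U = U and J = UNIV and x = x, OF \<alpha> U x] dom
    unfolding P_def T_def by auto
  define c where "c = det K * (\<Prod>i\<in>UNIV. A $ i $ i)"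
  have det: "det (mat 1 + K ** diag_mat (\<chi> i. s $ i * A $ i $ i)) = c * P s" for s
  proof -
    let ?S = "diag_mat (\<chi> i. s $ i * A $ i $ i)"
    have "mat 1 + K ** ?S = K ** (A + ?S)"
      by (simp add: matrix_add_ldistrib KA)
    moreover have "A + ?S = (\<chi> i. A $ i $ i *s (principal_block UNIV (T s) $ i))"
      using a by (simp add: vec_eq_iff principal_block_def T diag_mat_def less_imp_neq[symmetric])
    ultimately show ?thesis
      by (simp add: det_mul det_rows_mul c_def P_def)
  qed
  \<comment> \<open>Evaluating at s = 0 gives the sign of \<open>c\<close> without separate
    knowledge of the sign of \<open>det K\<close>; positivity allows \<open>powr\<close> to be split
    over the product.\<close>
  have "(\<chi> i. (0 :: real ^ 'n) $ i * A $ i $ i) = 0" by (simp add: vec_eq_iff)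
  moreover have "diag_mat 0 = (0 :: real ^ 'n ^ 'n)" by (simp add: diag_mat_def vec_eq_iff)
  ultimately have "c * P 0 = 1" using det[of 0] by simp
  moreover have "0 < P 0" using P by simp
  ultimately have c: "0 < c" by (metis zero_less_mult_pos2 zero_less_one)
  define F where "F s = c powr (- \<alpha>) * ((\<Prod>i\<in>UNIV. (1 + s $ i) powr \<alpha>) * P s powr (- \<alpha>))" for s
  have "geom_class F"
    unfolding F_def[abs_def] by (intro geom_class_mult[OF geom_class_const G]) simp
  moreover have "det (mat 1 + K ** diag_mat (\<chi> i. s $ i * A $ i $ i)) powr (- \<alpha>)
      = F s * (\<Prod>i\<in>UNIV. (1 + s $ i) powr (- \<alpha>))" if s: "0 \<le> s" for s
  proof -
    have "(1 + s $ i) powr \<alpha> * (1 + s $ i) powr (- \<alpha>) = 1" for i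
      using s by (simp add: vec_nonneg_iff add_pos_nonneg less_imp_neq[symmetric] flip: powr_add)
    then have "(\<Prod>i\<in>UNIV. (1 + s $ i) powr \<alpha>) * (\<Prod>i\<in>UNIV. (1 + s $ i) powr (- \<alpha>)) = 1"
      unfolding prod.distrib[symmetric] by simp
    moreover have "(c * P s) powr (- \<alpha>) = c powr (- \<alpha>) * P s powr (- \<alpha>)"
      using c P s by (simp add: powr_mult)
    ultimately show ?thesis
      unfolding det F_def by (simp add: algebra_simps)
  qed
  ultimately show ?thesis using that a by blast
qed

theorem theorem1p2:
  fixes \<alpha> :: real
    and K A :: "real ^ 'n ^ 'n"
    and M :: "'a measure" and X :: "'a \<Rightarrow> real ^ 'n"
    and N :: "'b measure" and \<xi> :: "'n \<Rightarrow> 'b \<Rightarrow> real"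
  assumes "\<alpha> > 0"
    and "permanental_vector M \<alpha> K X"
    and "invertible K"
    and "A = matrix_inv K"
    and "nonsingular_M_matrix A"
    and "prob_space N"
    and "prob_space.indep_vars N (\<lambda>_. borel) \<xi> UNIV"
    and "\<And>i. gamma_distributed N \<alpha> 1 (\<xi> i)"
  shows "(\<forall>f. increasing_on_orthant f
            \<and> has_expectation M (\<lambda>\<omega>. f (X \<omega>))
            \<and> has_expectation N (\<lambda>\<omega>. f (\<chi> i. inverse (A $ i $ i) * \<xi> i \<omega>))
          \<longrightarrow> ext_expectation M (\<lambda>\<omega>. f (X \<omega>))
                \<ge> ext_expectation N (\<lambda>\<omega>. f (\<chi> i. inverse (A $ i $ i) * \<xi> i \<omega>)))
       \<and> (\<forall>f. increasing_on_orthant f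
            \<and> has_expectation M (\<lambda>\<omega>. f (\<chi> i. A $ i $ i * X \<omega> $ i))
            \<and> has_expectation N (\<lambda>\<omega>. f (\<chi> i. \<xi> i \<omega>))
          \<longrightarrow> ext_expectation M (\<lambda>\<omega>. f (\<chi> i. A $ i $ i * X \<omega> $ i))
                \<ge> ext_expectation N (\<lambda>\<omega>. f (\<chi> i. \<xi> i \<omega>)))"
proof -
  have M: "prob_space M" and X [measurable]: "X \<in> borel_measurable M"
    and X_nonneg: "AE \<omega> in M. \<forall>i. 0 \<le> X \<omega> $ i"
    using assms(2) unfolding permanental_vector_def by auto
  have laplace: "(\<integral>\<omega>. exp (- (\<Sum>i\<in>UNIV. s $ i * X \<omega> $ i)) \<partial>M)
          = det (mat 1 + K ** diag_mat s) powr (- \<alpha>)" if "\<forall>i. 0 \<le> s $ i" for s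
    using assms(2) that unfolding permanental_vector_def by blast
  interpret M: prob_space M by fact
  interpret gamma_vector N \<alpha> \<xi>
    using assms by (simp add: gamma_vector_def gamma_vector_axioms_def)
  obtain F where a: "\<And>i. 0 < A $ i $ i" and F: "geom_class F"
    and det: "\<And>s. 0 \<le> s \<Longrightarrow> det (mat 1 + K ** diag_mat (\<chi> i. s $ i * A $ i $ i)) powr (- \<alpha>)
      = F s * (\<Prod>i\<in>UNIV. (1 + s $ i) powr (- \<alpha>))"
    using permanental_laplace_geom_class[OF assms(1,3,4,5)] by blast
  define Y where "Y \<omega> = (\<chi> i. A $ i $ i * X \<omega> $ i)" for \<omega>
  have Y [measurable]: "Y \<in> borel_measurable M" unfolding Y_def[abs_def] by measurable
  have Y_nonneg: "AE \<omega> in M. 0 \<le> Y \<omega>"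
    using X_nonneg a by (auto elim!: eventually_mono simp: Y_def vec_nonneg_iff less_imp_le)
  have Y_laplace: "(\<integral>\<^sup>+\<omega>. ennreal (exp (- (\<Sum>i\<in>UNIV. s $ i * Y \<omega> $ i))) \<partial>M)
      = ennreal (F s * (\<Prod>i\<in>UNIV. (1 + s $ i) powr (- \<alpha>)))" if s: "0 \<le> s" for s
  proof -
    let ?t = "\<chi> i. s $ i * A $ i $ i"
    have t: "\<forall>i. 0 \<le> ?t $ i" using s a by (simp add: vec_nonneg_iff less_imp_le)
    \<comment> \<open>The bound by 1 gives integrability, so the Bochner integral in the definition
      of a permanental vector equals the nonnegative integral.\<close>
    have "AE \<omega> in M. norm (exp (- (\<Sum>i\<in>UNIV. ?t $ i * X \<omega> $ i))) \<le> 1"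
      using X_nonneg s a
      by (auto elim!: eventually_mono simp: vec_nonneg_iff less_imp_le intro!: sum_nonneg mult_nonneg_nonneg)
    then have "integrable M (\<lambda>\<omega>. exp (- (\<Sum>i\<in>UNIV. ?t $ i * X \<omega> $ i)))"
      by (rule M.integrable_const_bound) measurable
    then have "(\<integral>\<^sup>+\<omega>. ennreal (exp (- (\<Sum>i\<in>UNIV. ?t $ i * X \<omega> $ i))) \<partial>M)
      = ennreal (det (mat 1 + K ** diag_mat ?t) powr (- \<alpha>))"
      by (simp add: nn_integral_eq_integral laplace[OF t, simplified])
    then show ?thesis
      unfolding det[OF s] by (simp add: Y_def mult.assoc)
  qed
  have dom: "ext_expectation N (\<lambda>\<omega>. f (G \<omega>)) \<le> ext_expectation M (\<lambda>\<omega>. f (Y \<omega>))"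
    if "increasing_on_orthant f" "has_expectation M (\<lambda>\<omega>. f (Y \<omega>))" "has_expectation N (\<lambda>\<omega>. f (G \<omega>))" for f
    using that unfolding increasing_on_orthant_def has_expectation_def
    by (intro ext_expectation_mono[OF M prob_space_axioms, where S = "{x. 0 \<le> x}"]
        stochastic_domination[OF M Y Y_nonneg F Y_laplace]) auto
  show ?thesis
  proof (intro conjI allI impI; elim conjE)
    fix f :: "real ^ 'n \<Rightarrow> real"
    assume f: "increasing_on_orthant f" "has_expectation M (\<lambda>\<omega>. f (X \<omega>))"
      "has_expectation N (\<lambda>\<omega>. f (\<chi> i. inverse (A $ i $ i) * \<xi> i \<omega>))"
    \<comment> \<open>Rescaling by the positive numbers 1 / a_i preserves the orthant and the order,
      so the unscaled inequality for f is the scaled one for g.\<close>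
    define g where "g y = f (\<chi> i. inverse (A $ i $ i) * y $ i)" for y
    have gY: "g (Y \<omega>) = f (X \<omega>)" for \<omega>
    proof -
      have "(\<chi> i. inverse (A $ i $ i) * Y \<omega> $ i) = X \<omega>"
        using a by (simp add: vec_eq_iff Y_def less_imp_neq[symmetric])
      then show ?thesis by (simp add: g_def)
    qed
    have gG: "g (G \<omega>) = f (\<chi> i. inverse (A $ i $ i) * \<xi> i \<omega>)" for \<omega>
      by (simp add: g_def G_def)
    have "increasing_on_orthant g"
      unfolding increasing_on_orthant_def g_def
      by (intro mono_onI mono_onD[OF f(1)[unfolded increasing_on_orthant_def]])
        (use a in \<open>auto simp: less_eq_vec_def less_imp_le intro!: mult_left_mono mult_nonneg_nonneg\<close>)
    then show "ext_expectation N (\<lambda>\<omega>. f (\<chi> i. inverse (A $ i $ i) * \<xi> i \<omega>)) \<le> ext_expectation M (\<lambda>\<omega>. f (X \<omega>))"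
      using dom[of g] f by (simp add: gY gG)
  next
    fix f :: "real ^ 'n \<Rightarrow> real"
    assume "increasing_on_orthant f" "has_expectation M (\<lambda>\<omega>. f (\<chi> i. A $ i $ i * X \<omega> $ i))"
      "has_expectation N (\<lambda>\<omega>. f (\<chi> i. \<xi> i \<omega>))"
    then show "ext_expectation N (\<lambda>\<omega>. f (\<chi> i. \<xi> i \<omega>)) \<le> ext_expectation M (\<lambda>\<omega>. f (\<chi> i. A $ i $ i * X \<omega> $ i))"
      using dom[of f] by (simp add: Y_def[abs_def] G_def[abs_def])
  qed
qed

end
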